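(* Consider a finite average-reward Markov decision process with $S$ states, $A$ actions and rewards in $[0,1]$, and let $\overline\pi_T$ be the policy output by the algorithm COMIDA-MDP (described in the context) after $T$ rounds with step sizes $\eta_v,\eta_\mu>0$, regularization parameter $\varrho_v=4\eta_\mu$, and initialization $\boldsymbol v_1=0$, $\boldsymbol\mu_1\in\Delta_{SA}$ arbitrary. Let $\pi^*$ be an optimal policy. Then $$\mathbb E\big[\langle\boldsymbol\mu^{\pi^*}-\boldsymbol\mu^{\overline\pi_T},\boldsymbol r\rangle\big]\le\frac{\mathcal D_{\mathrm{KL}}(\boldsymbol\mu^{\pi^*}\|\boldsymbol\mu_1)}{\eta_\mu T}+\eta_\mu+2\eta_v+\Big(\frac1{\eta_vT}+4\eta_\mu\Big)\mathbb E\big[\|\boldsymbol v^{\overline\pi_T}\|_2^2\big].$$ In particular, if the output policy satisfies $\|\boldsymbol v^{\overline\pi_T}\|_\infty\le B$ for some $B>0$, $\boldsymbol\mu_1$ is the uniform distribution over the $SA$ state-action pairs, and the parameters are tuned as $\eta_\mu=\sqrt{\frac{\log(SA)}{ST}}$ and $\eta_v=\sqrt{SA/T}$, then the bound becomes $$\mathbb E\big[\langle\boldsymbol\mu^{\pi^*}-\boldsymbol\mu^{\overline\pi_T},\boldsymbol r\rangle\big]=\mathcal O\left(\sqrt{\frac{B^4SA\log(SA)}{T}}\right).$$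
   Context: **MDP.** $\mathcal S,\mathcal A$ are finite sets with $|\mathcal S|=S$, $|\mathcal A|=A$; $r:\mathcal S\times\mathcal A\to[0,1]$ is the reward function (also seen as a vector $\boldsymbol r\in\mathbb R^{SA}$), and $P(\cdot|s,a)$ is a probability distribution on $\mathcal S$ for each $(s,a)$. $\Delta_{SA}$ is the set of probability distributions on $\mathcal S\times\mathcal A$. A (stationary stochastic) policy $\pi$ assigns to each $s$ a distribution $\pi(\cdot|s)$ on $\mathcal A$; it generates trajectories $a_k\sim\pi(\cdot|s_k)$, $s_{k+1}\sim P(\cdot|s_k,a_k)$. It is assumed that each policy $\pi$ has a well-defined unique stationary state distribution $\nu^\pi(s)=\lim_{K\to\infty}\frac1K\sum_{k=1}^K\mathbb P[s_k=s\mid\pi]$, which satisfies $\nu^\pi(s)=\sum_{s',a'}P(s|s',a')\pi(a'|s')\nu^\pi(s')$. Put $\mu^\pi(s,a)=\pi(a|s)\nu^\pi(s)$. The long-term average reward of $\pi$ is $\rho^\pi=\limsup_{K\to\infty}\frac1K\mathbb E_\pi\big[\sum_{k=1}^Kr(s_k,a_k)\big]=\langle\boldsymbol\mu^\pi,\boldsymbol r\rangle$. An optimal policy $\pi^*$ maximizes $\rho^\pi$ over policies. The value (bias) function $\boldsymbol v^\pi\in\mathbb R^S$ of $\pi$ is $v^\pi(s)=\lim_{K\to\infty}\mathbb E_\pi\big[\sum_{k=1}^K(r(s_k,a_k)-\rho^\pi)\mid s_1=s\big]$; it satisfies $v^\pi(s)=\sum_a\pi(a|s)\big[r(s,a)-\rho^\pi+\sum_{s'}P(s'|s,a)v^\pi(s')\big]$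 for all $s$. **Algorithm COMIDA-MDP.** Let $\boldsymbol e_s\in\mathbb R^S$, $\boldsymbol e_{(s,a)}\in\mathbb R^{SA}$ be standard basis vectors and $\mathcal D_{\mathrm{KL}}(\boldsymbol\mu\|\boldsymbol\mu')=\sum_{s,a}\mu(s,a)\log\frac{\mu(s,a)}{\mu'(s,a)}$. In round $t=1,\dots,T$, independently given the past, sample $(s_t,a_t)\sim\boldsymbol\mu_t$, $s'_t\sim P(\cdot|s_t,a_t)$, and for every $(s,a)$ a sample $\overline s'_t(s,a)\sim P(\cdot|s,a)$. Set $$\widetilde{\boldsymbol g}_v(t)=\boldsymbol e_{s'_t}-\boldsymbol e_{s_t},\qquad\widetilde{\boldsymbol g}_\mu(t)=\sum_{(s,a)}\big[r(s,a)+v_t(\overline s'_t(s,a))-v_t(s)\big]\boldsymbol e_{(s,a)},$$ $$\boldsymbol v_{t+1}=\arg\min_{\boldsymbol v\in\mathbb R^S}\Big\{\langle\boldsymbol v,\widetilde{\boldsymbol g}_v(t)\rangle+\tfrac1{2\eta_v}\|\boldsymbol v-\boldsymbol v_t\|_2^2+\varrho_v\|\boldsymbol v\|_\infty^2\Big\},$$ $$\boldsymbol\mu_{t+1}=\arg\min_{\boldsymbol\mu\in\Delta_{SA}}\Big\{-\langle\boldsymbol\mu,\widetilde{\boldsymbol g}_\mu(t)\rangle+\tfrac1{\eta_\mu}\mathcal D_{\mathrm{KL}}(\boldsymbol\mu\|\boldsymbol\mu_t)\Big\}.$$ With $\overline\mu_T=\frac1T\sum_{t=1}^T\mu_t$,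 the output policy is $\overline\pi_T(a|s)=\overline\mu_T(s,a)/\sum_{a'\in\mathcal A}\overline\mu_T(s,a')$ for all $s,a$. *)

theory Defs
  imports "HOL-Probability.Probability"
begin

text \<open>
  States and actions are finite carrier sets rather than finite types, so that a constant can be
  quantified outside the MDP and hence be independent of the numbers of states and actions
  (take both carrier types to be \<^typ>\<open>nat\<close>).
\<close>

record ('s, 'a) mdp =
  states :: "'s set"
  actions :: "'a set"
  reward :: "'s \<Rightarrow> 'a \<Rightarrow> real"
  trans_prob :: "'s \<Rightarrow> 'a \<Rightarrow> 's pmf"

definition policies :: "('s, 'a) mdp \<Rightarrow> ('s \<Rightarrow> 'a pmf) set" where
  "policies M = {\<pi>. \<forall>s\<in>states M. set_pmf (\<pi> s) \<subseteq> actions M}"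

text \<open>Law of \<open>[(s\<^sub>1, a\<^sub>1), \<dots>, (s\<^sub>K, a\<^sub>K)]\<close> under \<open>\<pi>\<close>, given the initial state \<open>s\<^sub>1\<close>.\<close>

primrec trajectory ::
  "('s, 'a) mdp \<Rightarrow> ('s \<Rightarrow> 'a pmf) \<Rightarrow> nat \<Rightarrow> 's \<Rightarrow> ('s \<times> 'a) list pmf" where
  "trajectory M \<pi> 0 s = return_pmf []"
| "trajectory M \<pi> (Suc K) s =
     bind_pmf (\<pi> s) (\<lambda>a. bind_pmf (trans_prob M s a)
       (\<lambda>s'. map_pmf ((#) (s, a)) (trajectory M \<pi> K s')))"

definition visit_freq :: "('s, 'a) mdp \<Rightarrow> ('s \<Rightarrow> 'a pmf) \<Rightarrow> 's \<Rightarrow> nat \<Rightarrow> 's \<Rightarrow> real" where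
  "visit_freq M \<pi> s\<^sub>1 K s =
     (\<Sum>k<K. measure_pmf.prob (trajectory M \<pi> K s\<^sub>1) {\<tau>. fst (\<tau> ! k) = s}) / real K"

text \<open>The limit is required to be the same from every initial state; equivalently, the Markov
  chain induced by \<open>\<pi>\<close> has exactly one invariant distribution.\<close>

definition is_stationary_dist :: "('s, 'a) mdp \<Rightarrow> ('s \<Rightarrow> 'a pmf) \<Rightarrow> ('s \<Rightarrow> real) \<Rightarrow> bool" where
  "is_stationary_dist M \<pi> \<nu> \<longleftrightarrow>
     (\<forall>s\<^sub>1\<in>states M. \<forall>s. (\<lambda>K. visit_freq M \<pi> s\<^sub>1 K s) \<longlonglongrightarrow> \<nu> s)"

definition stationary_dist :: "('s, 'a) mdp \<Rightarrow> ('s \<Rightarrow> 'a pmf) \<Rightarrow> 's \<Rightarrow> real" where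
  "stationary_dist M \<pi> = (THE \<nu>. is_stationary_dist M \<pi> \<nu>)"

definition occupancy :: "('s, 'a) mdp \<Rightarrow> ('s \<Rightarrow> 'a pmf) \<Rightarrow> 's \<times> 'a \<Rightarrow> real" where
  "occupancy M \<pi> = (\<lambda>(s, a). pmf (\<pi> s) a * stationary_dist M \<pi> s)"

text \<open>The average reward carries its initial state explicitly; it does not depend on it
  when the stationary distribution is well defined.\<close>

definition avg_reward :: "('s, 'a) mdp \<Rightarrow> ('s \<Rightarrow> 'a pmf) \<Rightarrow> 's \<Rightarrow> real" where
  "avg_reward M \<pi> s\<^sub>1 = real_of_ereal (limsup (\<lambda>K. ereal
     (measure_pmf.expectation (trajectory M \<pi> K s\<^sub>1) (\<lambda>\<tau>. \<Sum>(s, a)\<leftarrow>\<tau>. reward M s a) / real K)))"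

definition optimal_policy :: "('s, 'a) mdp \<Rightarrow> ('s \<Rightarrow> 'a pmf) \<Rightarrow> bool" where
  "optimal_policy M \<pi> \<longleftrightarrow> \<pi> \<in> policies M \<and>
     (\<forall>\<pi>'\<in>policies M. \<forall>s\<in>states M. avg_reward M \<pi>' s \<le> avg_reward M \<pi> s)"

definition partial_bias :: "('s, 'a) mdp \<Rightarrow> ('s \<Rightarrow> 'a pmf) \<Rightarrow> 's \<Rightarrow> nat \<Rightarrow> real" where
  "partial_bias M \<pi> s\<^sub>1 K = measure_pmf.expectation (trajectory M \<pi> K s\<^sub>1)
     (\<lambda>\<tau>. \<Sum>(s, a)\<leftarrow>\<tau>. (reward M s a - avg_reward M \<pi> s\<^sub>1))"

definition bias :: "('s, 'a) mdp \<Rightarrow> ('s \<Rightarrow> 'a pmf) \<Rightarrow> 's \<Rightarrow> real" where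
  "bias M \<pi> s = lim (partial_bias M \<pi> s)"

text \<open>The last two clauses say that the limits defining the stationary distribution and the
  value function of a policy exist (the latter fails for periodic chains).\<close>

definition average_reward_mdp :: "('s, 'a) mdp \<Rightarrow> bool" where
  "average_reward_mdp M \<longleftrightarrow>
     finite (states M) \<and> states M \<noteq> {} \<and> finite (actions M) \<and> actions M \<noteq> {} \<and>
     (\<forall>s\<in>states M. \<forall>a\<in>actions M.
        0 \<le> reward M s a \<and> reward M s a \<le> 1 \<and> set_pmf (trans_prob M s a) \<subseteq> states M) \<and>
     (\<forall>\<pi>\<in>policies M. \<exists>!\<nu>. is_stationary_dist M \<pi> \<nu>) \<and>
     (\<forall>\<pi>\<in>policies M. \<forall>s\<in>states M. convergent (partial_bias M \<pi> s))"

definition state_vectors :: "('s, 'a) mdp \<Rightarrow> ('s \<Rightarrow> real) set" where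
  "state_vectors M = {v. \<forall>s. s \<notin> states M \<longrightarrow> v s = 0}"

definition sup_norm :: "('s, 'a) mdp \<Rightarrow> ('s \<Rightarrow> real) \<Rightarrow> real" where
  "sup_norm M v = Max ((\<lambda>s. \<bar>v s\<bar>) ` states M)"

definition sa_inner :: "('s, 'a) mdp \<Rightarrow> ('s \<times> 'a \<Rightarrow> real) \<Rightarrow> ('s \<times> 'a \<Rightarrow> real) \<Rightarrow> real" where
  "sa_inner M x y = (\<Sum>z\<in>states M \<times> actions M. x z * y z)"

definition sa_simplex :: "('s, 'a) mdp \<Rightarrow> ('s \<times> 'a) pmf set" where
  "sa_simplex M = {\<mu>. set_pmf \<mu> \<subseteq> states M \<times> actions M}"

text \<open>With the usual conventions \<open>0 log (0 / q) = 0\<close> and \<open>p log (p / 0) = \<infinity>\<close> for \<open>p > 0\<close>.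
  The library's \<open>KL_divergence\<close> is real-valued and so does not provide the second.\<close>

definition KL_div :: "('s, 'a) mdp \<Rightarrow> ('s \<times> 'a \<Rightarrow> real) \<Rightarrow> ('s \<times> 'a \<Rightarrow> real) \<Rightarrow> ereal" where
  "KL_div M \<mu> \<mu>' =
     (if \<exists>z\<in>states M \<times> actions M. \<mu> z \<noteq> 0 \<and> \<mu>' z = 0 then \<infinity>
      else ereal (\<Sum>z\<in>states M \<times> actions M. \<mu> z * ln (\<mu> z / \<mu>' z)))"

definition v_update ::
  "('s, 'a) mdp \<Rightarrow> real \<Rightarrow> real \<Rightarrow> ('s \<Rightarrow> real) \<Rightarrow> ('s \<Rightarrow> real) \<Rightarrow> 's \<Rightarrow> real" where
  "v_update M \<eta>\<^sub>v \<rho>\<^sub>v v\<^sub>t g = arg_min_on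
     (\<lambda>v. (\<Sum>s\<in>states M. v s * g s)
        + 1 / (2 * \<eta>\<^sub>v) * (L2_set (\<lambda>s. v s - v\<^sub>t s) (states M))\<^sup>2
        + \<rho>\<^sub>v * (sup_norm M v)\<^sup>2)
     (state_vectors M)"

definition \<mu>_update ::
  "('s, 'a) mdp \<Rightarrow> real \<Rightarrow> ('s \<times> 'a) pmf \<Rightarrow> ('s \<times> 'a \<Rightarrow> real) \<Rightarrow> ('s \<times> 'a) pmf" where
  "\<mu>_update M \<eta>\<^sub>\<mu> \<mu>\<^sub>t g = arg_min_on
     (\<lambda>\<mu>. ereal (- sa_inner M (pmf \<mu>) g) + ereal (1 / \<eta>\<^sub>\<mu>) * KL_div M (pmf \<mu>) (pmf \<mu>\<^sub>t))
     (sa_simplex M)"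

definition comida_round ::
  "('s, 'a) mdp \<Rightarrow> real \<Rightarrow> real \<Rightarrow> real \<Rightarrow> ('s \<Rightarrow> real) \<times> ('s \<times> 'a) pmf
     \<Rightarrow> (('s \<Rightarrow> real) \<times> ('s \<times> 'a) pmf) pmf" where
  "comida_round M \<eta>\<^sub>v \<eta>\<^sub>\<mu> \<rho>\<^sub>v = (\<lambda>(v, \<mu>).
     bind_pmf \<mu> (\<lambda>(s, a).
     bind_pmf (trans_prob M s a) (\<lambda>s'.
     bind_pmf (Pi_pmf (states M \<times> actions M) undefined (\<lambda>(x, b). trans_prob M x b)) (\<lambda>sbar.
     return_pmf
       (v_update M \<eta>\<^sub>v \<rho>\<^sub>v v (\<lambda>x. of_bool (x = s') - of_bool (x = s)),
        \<mu>_update M \<eta>\<^sub>\<mu> \<mu> (\<lambda>(x, b). reward M x b + v (sbar (x, b)) - v x))))))"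

text \<open>Law of the iterates \<open>[(v\<^sub>1, \<mu>\<^sub>1), \<dots>, (v\<^sub>T, \<mu>\<^sub>T)]\<close>; the iterate produced by round \<open>T\<close> is unused.\<close>

primrec comida_iterates ::
  "('s, 'a) mdp \<Rightarrow> real \<Rightarrow> real \<Rightarrow> real \<Rightarrow> nat \<Rightarrow> ('s \<Rightarrow> real) \<times> ('s \<times> 'a) pmf
     \<Rightarrow> (('s \<Rightarrow> real) \<times> ('s \<times> 'a) pmf) list pmf" where
  "comida_iterates M \<eta>\<^sub>v \<eta>\<^sub>\<mu> \<rho>\<^sub>v 0 x = return_pmf []"
| "comida_iterates M \<eta>\<^sub>v \<eta>\<^sub>\<mu> \<rho>\<^sub>v (Suc T) x =
     bind_pmf (comida_round M \<eta>\<^sub>v \<eta>\<^sub>\<mu> \<rho>\<^sub>v x)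
       (\<lambda>y. map_pmf ((#) x) (comida_iterates M \<eta>\<^sub>v \<eta>\<^sub>\<mu> \<rho>\<^sub>v T y))"

definition average_iterate :: "(('s \<Rightarrow> real) \<times> ('s \<times> 'a) pmf) list \<Rightarrow> 's \<times> 'a \<Rightarrow> real" where
  "average_iterate xs z = (\<Sum>(v, \<mu>)\<leftarrow>xs. pmf \<mu> z) / real (length xs)"

text \<open>In a state to which the average iterate gives no mass (possible only if \<open>\<mu>\<^sub>1\<close> gives it none)
  the quotient is \<open>0 / 0\<close>; there the output follows an arbitrary fallback policy \<open>\<pi>\<^sub>0\<close>.\<close>

definition output_policy ::
  "('s, 'a) mdp \<Rightarrow> ('s \<Rightarrow> 'a pmf) \<Rightarrow> (('s \<Rightarrow> real) \<times> ('s \<times> 'a) pmf) list \<Rightarrow> 's \<Rightarrow> 'a pmf" where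
  "output_policy M \<pi>\<^sub>0 xs s =
     (let d = \<Sum>a\<in>actions M. average_iterate xs (s, a)
      in if d = 0 then \<pi>\<^sub>0 s else embed_pmf (\<lambda>a. average_iterate xs (s, a) / d))"

text \<open>Law of the policy returned after \<open>T\<close> rounds, from \<open>v\<^sub>1 = 0\<close>.\<close>

definition comida_mdp ::
  "('s, 'a) mdp \<Rightarrow> real \<Rightarrow> real \<Rightarrow> real \<Rightarrow> ('s \<times> 'a) pmf \<Rightarrow> ('s \<Rightarrow> 'a pmf) \<Rightarrow> nat
     \<Rightarrow> ('s \<Rightarrow> 'a pmf) pmf" where
  "comida_mdp M \<eta>\<^sub>v \<eta>\<^sub>\<mu> \<rho>\<^sub>v \<mu>\<^sub>1 \<pi>\<^sub>0 T =
     map_pmf (output_policy M \<pi>\<^sub>0) (comida_iterates M \<eta>\<^sub>v \<eta>\<^sub>\<mu> \<rho>\<^sub>v T (\<lambda>_. 0, \<mu>\<^sub>1))"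

definition suboptimality :: "('s, 'a) mdp \<Rightarrow> ('s \<Rightarrow> 'a pmf) \<Rightarrow> ('s \<Rightarrow> 'a pmf) \<Rightarrow> real" where
  "suboptimality M \<pi>' \<pi> =
     sa_inner M (\<lambda>z. occupancy M \<pi>' z - occupancy M \<pi> z) (\<lambda>(s, a). reward M s a)"

end

theory Submission
  imports Defs
begin

text \<open>
  For any \<open>v\<close>, stationarity of \<open>\<mu>\<^sup>*\<close> and the Bellman equation of the output policy \<open>\<pi>\<close> turn \<open>T\<close> times
  the suboptimality into the duality gap summed over the iterates, i.e. into the regret of the
  \<open>\<mu>\<close>-player against \<open>\<mu>\<^sup>*\<close> plus that of the \<open>v\<close>-player against the bias vector \<open>u\<close> of \<open>\<pi>\<close>. Exponential
  weights and Hoeffding's lemma cost the \<open>\<mu>\<close>-player \<open>\<eta>\<^sub>\<mu> + 4 \<eta>\<^sub>\<mu> \<parallel>v\<^sub>t\<parallel>\<^sup>2\<close> (supremum norm) per round; the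
  regularization \<open>4 \<eta>\<^sub>\<mu> \<parallel>v\<parallel>\<^sup>2\<close> of the \<open>v\<close>-player pays the second term back one round earlier. As \<open>u\<close> depends
  on the whole run, the noise of the \<open>v\<close>-gradients does not average out against it; it is instead
  bounded by \<open>\<parallel>u\<parallel>\<^sup>2 / (2 \<eta>\<^sub>v)\<close> plus \<open>\<eta>\<^sub>v / 2\<close> times the squared norm of the accumulated noise.
\<close>

section \<open>Exponential weights\<close>

text \<open>The run is a finitely supported law on lists of iterates, so expectations are finite
  sums and a comparator may be any function of the list. The recursion over rounds carries four
  credits: the relative entropy of the comparator to the current weights,
  \<open>4 * \<eta>\<^sub>\<mu>\<close> times the squared supremum norm of the current
  \<open>v\<close>, a fixed charge per remaining round, and the noise term. Origin of the constants:
  sampled mu-gradients lie in an interval of width \<open>1 + 4 * V\<close>, where \<open>V\<close>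
  is the supremum norm of \<open>v\<close>, and Hoeffding's lemma charges
  \<open>(1 + 4 * V)\<^sup>2 / 8\<close>, at most \<open>1 + 4 * V\<^sup>2\<close>. Starting at the
  zero vector leaves no first term unpaid. The charge \<open>2 * \<eta>\<^sub>v\<close> is one
  \<open>\<eta>\<^sub>v\<close> for the squared length of a sampled v-gradient in the proximal step
  and one for the growth of the squared noise. The coefficient of the squared bias norm,
  \<open>1 / \<eta>\<^sub>v\<close> before division by \<open>T\<close>, is one half for the
  proximal distance from zero and one half for the Fenchel-Young inequality. The noise of the
  mu-gradients does average out, because the optimal occupancy is fixed before the run.\<close>

lemma expectation_finite_support:
  assumes "finite A" "set_pmf p \<subseteq> A"
  shows "measure_pmf.expectation p f = (\<Sum>x\<in>A. pmf p x * (f x :: real))"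
  by (subst integral_measure_pmf_real[of A]) (use assms in \<open>auto simp: mult.commute\<close>)

lemma pmf_embed_finite:
  assumes "finite A" "\<And>x. 0 \<le> f x" "\<And>x. x \<notin> A \<Longrightarrow> f x = 0" "sum f A = 1"
  shows "pmf (embed_pmf f) x = f x"
proof (rule pmf_embed_pmf)
  have "(\<integral>\<^sup>+x. ennreal (f x) \<partial>count_space UNIV) = (\<Sum>x\<in>A. ennreal (f x))"
    by (rule nn_integral_count_space'[of A]) (use assms in auto)
  also have "\<dots> = 1"
    using assms by (simp add: sum_ennreal)
  finally show "(\<integral>\<^sup>+x. ennreal (f x) \<partial>count_space UNIV) = 1" .
qed (use assms in auto)

text \<open>The tangent bound \<open>ln w \<le> w - 1\<close> at \<open>w = y / x\<close>. The
  equality case serves to identify the minimizer of the mu-step.\<close>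

lemma xlog_ratio_ge:
  assumes "0 \<le> x" "0 \<le> y" "y = 0 \<longrightarrow> x = 0"
  shows "x - y \<le> x * ln (x / y :: real)"
    and "x * ln (x / y) = x - y \<Longrightarrow> x = y"
proof -
  consider "x = 0" | "0 < x" "0 < y" using assms by linarith
  then have "x - y \<le> x * ln (x / y) \<and> (x * ln (x / y) = x - y \<longrightarrow> x = y)"
  proof cases
    case 2
    have "ln (y / x) \<le> y / x - 1" using 2 by (intro ln_le_minus_one) auto
    moreover have "ln (y / x) = - ln (x / y)" using 2 by (simp add: ln_div)
    ultimately have "x * (1 - y / x) \<le> x * ln (x / y)" using 2 by (intro mult_left_mono) auto
    moreover have "x * (1 - y / x) = x - y" using 2 by (simp add: field_simps)
    moreover have "x = y" if "x * ln (x / y) = x - y"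
    proof -
      have "x * ln (x / y) = x * (1 - y / x)" using that 2 \<open>x * (1 - y / x) = x - y\<close> by simp
      then have "ln (y / x) = y / x - 1" using 2 \<open>ln (y / x) = - ln (x / y)\<close> by simp
      then have "y / x = 1" using 2 by (intro ln_eq_minus_one) auto
      then show ?thesis using 2 by simp
    qed
    ultimately show ?thesis by auto
  qed (use assms in auto)
  then show "x - y \<le> x * ln (x / y)" "x * ln (x / y) = x - y \<Longrightarrow> x = y" by auto
qed

text \<open>Gibbs' inequality with its equality case: the linear parts of the pointwise bounds
  cancel in the sum, and nonnegative slacks with sum 0 all vanish.\<close>

lemma relative_entropy_nonneg:
  fixes x y :: "'z \<Rightarrow> real"
  assumes "finite Z" "\<And>z. z \<in> Z \<Longrightarrow> 0 \<le> x z" "\<And>z. z \<in> Z \<Longrightarrow> 0 \<le> y z"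
    "\<And>z. z \<in> Z \<Longrightarrow> y z = 0 \<Longrightarrow> x z = 0" "sum x Z = sum y Z"
  shows "0 \<le> (\<Sum>z\<in>Z. x z * ln (x z / y z))"
    and "(\<Sum>z\<in>Z. x z * ln (x z / y z)) \<le> 0 \<Longrightarrow> z \<in> Z \<Longrightarrow> x z = y z"
proof -
  have ge: "x z - y z \<le> x z * ln (x z / y z)" if "z \<in> Z" for z
    using assms(2-4) that by (intro xlog_ratio_ge(1)) auto
  have "(\<Sum>z\<in>Z. x z - y z) \<le> (\<Sum>z\<in>Z. x z * ln (x z / y z))"
    by (intro sum_mono ge)
  moreover have "(\<Sum>z\<in>Z. x z - y z) = 0" using assms(5) by (simp add: sum_subtractf)
  ultimately show nonneg: "0 \<le> (\<Sum>z\<in>Z. x z * ln (x z / y z))" by simp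
  define h where "h z = x z * ln (x z / y z) - (x z - y z)" for z
  assume "(\<Sum>z\<in>Z. x z * ln (x z / y z)) \<le> 0" and z: "z \<in> Z"
  then have "sum h Z = 0"
    using nonneg \<open>(\<Sum>z\<in>Z. x z - y z) = 0\<close> by (simp add: sum_subtractf h_def)
  moreover have "0 \<le> h z" if "z \<in> Z" for z using ge[OF that] by (simp add: h_def)
  ultimately have "h z = 0" using sum_nonneg_0[of Z h z] assms(1) z by blast
  then have "x z * ln (x z / y z) = x z - y z" by (simp add: h_def)
  then show "x z = y z"
    using xlog_ratio_ge(2)[of "x z" "y z"] assms(2-4)[OF z] by blast
qed

text \<open>Used twice: with a competitor as \<open>x\<close> it rewrites the objective of the
  mu-step, and with the comparator as \<open>x\<close> it gives the regret of that step.\<close>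

lemma relative_entropy_exp_weights:
  fixes x p g :: "'z \<Rightarrow> real"
  assumes "\<And>z. z \<in> Z \<Longrightarrow> 0 \<le> p z" "\<And>z. z \<in> Z \<Longrightarrow> 0 \<le> x z"
    "\<And>z. z \<in> Z \<Longrightarrow> p z = 0 \<Longrightarrow> x z = 0" "sum x Z = 1" "0 < W"
  shows "(\<Sum>z\<in>Z. x z * ln (x z / (p z * exp (\<eta> * g z) / W)))
    = (\<Sum>z\<in>Z. x z * ln (x z / p z)) - \<eta> * (\<Sum>z\<in>Z. x z * g z) + ln W"
proof -
  have "x z * ln (x z / (p z * exp (\<eta> * g z) / W))
      = x z * ln (x z / p z) - \<eta> * (x z * g z) + x z * ln W" if "z \<in> Z" for z
  proof (cases "x z = 0")
    case False
    then have "0 < x z" "0 < p z" using assms(1-3)[OF that] by (auto simp: less_le)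
    then have "ln (x z / (p z * exp (\<eta> * g z) / W)) = ln (x z / p z) - \<eta> * g z + ln W"
      using \<open>0 < W\<close> by (simp add: ln_div ln_mult)
    then show ?thesis by (simp only: ring_distribs) (simp only: mult_ac)
  qed simp
  then have "(\<Sum>z\<in>Z. x z * ln (x z / (p z * exp (\<eta> * g z) / W)))
      = (\<Sum>z\<in>Z. x z * ln (x z / p z) - \<eta> * (x z * g z) + x z * ln W)"
    by (intro sum.cong) auto
  also have "\<dots> = (\<Sum>z\<in>Z. x z * ln (x z / p z)) - \<eta> * (\<Sum>z\<in>Z. x z * g z) + ln W"
    using assms(4) by (simp add: sum.distrib sum_subtractf sum_distrib_left flip: sum_distrib_right)
  finally show ?thesis .
qed

lemma mgf_pos:
  assumes "finite Z" "set_pmf p \<subseteq> Z"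
  shows "0 < (\<Sum>z\<in>Z. pmf p z * exp (c * g z :: real))"
proof -
  obtain z where "z \<in> set_pmf p" using set_pmf_not_empty[of p] by blast
  then show ?thesis using assms
    by (intro sum_pos2[of _ z]) (auto simp: pmf_positive)
qed

lemma log_mgf_le:
  assumes "finite Z" "set_pmf p \<subseteq> Z" "\<And>z. z \<in> Z \<Longrightarrow> g z \<in> {a..b}" "0 < \<eta>"
  shows "ln (\<Sum>z\<in>Z. pmf p z * exp (\<eta> * g z)) \<le> \<eta> * (\<Sum>z\<in>Z. pmf p z * g z) + \<eta>\<^sup>2 * (b - a)\<^sup>2 / 8"
proof -
  interpret interval_bounded_random_variable "measure_pmf p" g a b
    by unfold_locales (use assms in \<open>auto simp: AE_measure_pmf_iff\<close>)
  let ?E = "\<Sum>z\<in>Z. pmf p z * g z" and ?W = "\<Sum>z\<in>Z. pmf p z * exp (\<eta> * g z)"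
  have E: "measure_pmf.expectation p g = ?E"
    by (rule expectation_finite_support) fact+
  have int: "integrable (measure_pmf p) (\<lambda>z. exp (\<eta> * (g z - ?E)))"
    by (rule integrable_measure_pmf_finite) (use assms finite_subset in blast)
  have "ennreal (measure_pmf.expectation p (\<lambda>z. exp (\<eta> * (g z - ?E))))
      = (\<integral>\<^sup>+z. exp (\<eta> * (g z - ?E)) \<partial>measure_pmf p)"
    by (rule nn_integral_eq_integral[symmetric]) (use int in auto)
  also have "\<dots> \<le> ennreal (exp (\<eta>\<^sup>2 * (b - a)\<^sup>2 / 8))"
    using Hoeffdings_lemma_nn_integral[OF \<open>0 < \<eta>\<close>] by (simp add: E)
  finally have "measure_pmf.expectation p (\<lambda>z. exp (\<eta> * (g z - ?E))) \<le> exp (\<eta>\<^sup>2 * (b - a)\<^sup>2 / 8)"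
    by simp
  also have "measure_pmf.expectation p (\<lambda>z. exp (\<eta> * (g z - ?E))) = ?W / exp (\<eta> * ?E)"
    unfolding expectation_finite_support[OF assms(1,2)]
    by (simp add: right_diff_distrib exp_diff sum_divide_distrib)
  finally have W: "?W \<le> exp (\<eta> * ?E + \<eta>\<^sup>2 * (b - a)\<^sup>2 / 8)"
    by (simp add: exp_add divide_le_eq mult.commute)
  have "0 < ?W" using assms(1,2) by (rule mgf_pos)
  with W have "ln ?W \<le> ln (exp (\<eta> * ?E + \<eta>\<^sup>2 * (b - a)\<^sup>2 / 8))"
    by (subst ln_le_cancel_iff) auto
  then show ?thesis by simp
qed

text \<open>On distributions that put no mass where \<open>p\<close> has none, the objective is, up
  to the factor \<open>1 / \<eta>\<close> and an additive constant, the relative entropy to the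
  exponential weights \<open>q\<close>; on all others it is infinite. Since
  \<open>arg_min_on\<close> only chooses some minimizer, the equality case of Gibbs' inequality is
  what identifies the choice with \<open>q\<close>.\<close>

lemma pmf_mu_update:
  fixes M :: "('s, 'a) mdp" and g :: "'s \<times> 'a \<Rightarrow> real"
  defines "Z \<equiv> states M \<times> actions M"
  assumes "finite (states M)" "finite (actions M)" "p \<in> sa_simplex M" "0 < \<eta>"
  shows "pmf (\<mu>_update M \<eta> p g) z = pmf p z * exp (\<eta> * g z) / (\<Sum>y\<in>Z. pmf p y * exp (\<eta> * g y))"
    and "\<mu>_update M \<eta> p g \<in> sa_simplex M"
proof -
  define W where "W = (\<Sum>y\<in>Z. pmf p y * exp (\<eta> * g y))"
  define q where "q = (\<lambda>z. pmf p z * exp (\<eta> * g z) / W)"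
  define F where "F = (\<lambda>\<mu>. ereal (- sa_inner M (pmf \<mu>) g)
    + ereal (1 / \<eta>) * KL_div M (pmf \<mu>) (pmf p))"
  have Z: "finite Z" "set_pmf p \<subseteq> Z" using assms unfolding Z_def sa_simplex_def by auto
  have W: "0 < W" unfolding W_def using Z by (rule mgf_pos)
  have p0: "pmf p z = 0" if "z \<notin> Z" for z using Z that by (meson pmf_eq_0_set_pmf subsetD)
  have sq: "sum q Z = 1"
    using W unfolding q_def by (simp flip: sum_divide_distrib add: W_def)
  have pmf_q: "pmf (embed_pmf q) z = q z" for z
    by (rule pmf_embed_finite[of Z]) (use Z W p0 sq in \<open>auto simp: q_def\<close>)
  then have "set_pmf (embed_pmf q) \<subseteq> Z"
    using p0 by (auto simp: set_pmf_eq q_def)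
  then have q_simplex: "embed_pmf q \<in> sa_simplex M" by (simp add: sa_simplex_def Z_def)
  have sum1: "sum (pmf \<mu>) Z = 1" if "\<mu> \<in> sa_simplex M" for \<mu>
    by (rule sum_pmf_eq_1) (use that Z in \<open>auto simp: sa_simplex_def Z_def\<close>)
  have F_eq: "F \<mu> = ereal (((\<Sum>z\<in>Z. pmf \<mu> z * ln (pmf \<mu> z / q z)) - ln W) / \<eta>)"
    if "\<mu> \<in> sa_simplex M" and ac: "\<And>z. z \<in> Z \<Longrightarrow> pmf p z = 0 \<Longrightarrow> pmf \<mu> z = 0" for \<mu>
  proof -
    have "(\<Sum>z\<in>Z. pmf \<mu> z * ln (pmf \<mu> z / q z)) = (\<Sum>z\<in>Z. pmf \<mu> z * ln (pmf \<mu> z / pmf p z))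
        - \<eta> * (\<Sum>z\<in>Z. pmf \<mu> z * g z) + ln W"
      unfolding q_def by (rule relative_entropy_exp_weights) (use W ac sum1 that in auto)
    then show ?thesis
      using ac \<open>0 < \<eta>\<close> unfolding F_def KL_div_def sa_inner_def
      by (auto simp: field_simps Z_def)
  qed
  have F_inf: "F \<mu> = \<infinity>" if "z \<in> Z" "pmf p z = 0" "pmf \<mu> z \<noteq> 0" for \<mu> z
    using that \<open>0 < \<eta>\<close> unfolding F_def KL_div_def Z_def by auto
  have ac_q: "pmf (embed_pmf q) z = 0" if "pmf p z = 0" for z
    using that by (simp add: pmf_q) (simp add: q_def)
  have gibbs: "0 \<le> (\<Sum>z\<in>Z. pmf \<mu> z * ln (pmf \<mu> z / q z))"
    "(\<Sum>z\<in>Z. pmf \<mu> z * ln (pmf \<mu> z / q z)) \<le> 0 \<Longrightarrow> \<forall>z\<in>Z. pmf \<mu> z = q z"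
    if "\<mu> \<in> sa_simplex M" and ac: "\<And>z. z \<in> Z \<Longrightarrow> pmf p z = 0 \<Longrightarrow> pmf \<mu> z = 0" for \<mu>
  proof -
    have q: "q z = 0 \<Longrightarrow> pmf \<mu> z = 0" "0 \<le> q z" if "z \<in> Z" for z
      using ac[OF that] W by (simp_all add: q_def)
    have sums: "sum (pmf \<mu>) Z = sum q Z" using sum1[OF that(1)] sq by simp
    show "0 \<le> (\<Sum>z\<in>Z. pmf \<mu> z * ln (pmf \<mu> z / q z))"
      by (rule relative_entropy_nonneg(1)[OF \<open>finite Z\<close> pmf_nonneg q(2) q(1) sums])
    show "\<forall>z\<in>Z. pmf \<mu> z = q z" if "(\<Sum>z\<in>Z. pmf \<mu> z * ln (pmf \<mu> z / q z)) \<le> 0"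
      by (intro ballI relative_entropy_nonneg(2)[OF \<open>finite Z\<close> pmf_nonneg q(2) q(1) sums that])
  qed
  have Fq: "F (embed_pmf q) = ereal (- ln W / \<eta>)"
  proof -
    have "(\<Sum>z\<in>Z. q z * ln (q z / q z)) = 0" by (intro sum.neutral) auto
    then show ?thesis using F_eq[OF q_simplex ac_q] by (simp only: pmf_q) simp
  qed
  have q_min: "F (embed_pmf q) \<le> F \<mu>" if "\<mu> \<in> sa_simplex M" for \<mu>
  proof (cases "\<forall>z\<in>Z. pmf p z = 0 \<longrightarrow> pmf \<mu> z = 0")
    case True
    then show ?thesis
      using gibbs(1)[of \<mu>] that \<open>0 < \<eta>\<close>
      by (auto simp: Fq F_eq diff_divide_distrib intro!: divide_nonneg_pos)
  qed (auto simp: F_inf)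
  let ?m = "\<mu>_update M \<eta> p g"
  have m: "?m = arg_min F (\<lambda>\<mu>. \<mu> \<in> sa_simplex M)"
    unfolding \<mu>_update_def arg_min_on_def F_def ..
  show simplex: "?m \<in> sa_simplex M"
    unfolding m by (rule arg_minI[of _ "embed_pmf q"]) (use q_simplex q_min in \<open>auto simp: not_less\<close>)
  have "F ?m = F (embed_pmf q)"
    unfolding m by (rule arg_min_equality) (use q_simplex q_min in auto)
  then have Fm: "F ?m = ereal (- ln W / \<eta>)" using Fq by simp
  \<comment> \<open>A finite objective value rules out mass where \<open>p\<close> has none.\<close>
  then have ac: "pmf ?m z = 0" if "z \<in> Z" "pmf p z = 0" for z
    using F_inf[OF that, of ?m] by auto
  have "(\<Sum>z\<in>Z. pmf ?m z * ln (pmf ?m z / q z)) \<le> 0"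
    using Fm F_eq[OF simplex ac] \<open>0 < \<eta>\<close> by (simp add: diff_divide_distrib)
  then have "\<forall>z\<in>Z. pmf ?m z = q z" using gibbs(2)[OF simplex] ac by blast
  moreover have "pmf ?m z = 0" if "z \<notin> Z"
    using simplex that unfolding sa_simplex_def Z_def by (meson pmf_eq_0_set_pmf subsetD mem_Collect_eq)
  ultimately show "pmf ?m z = pmf p z * exp (\<eta> * g z) / (\<Sum>y\<in>Z. pmf p y * exp (\<eta> * g y))"
    using p0 by (cases "z \<in> Z") (auto simp: q_def W_def)
qed

text \<open>The log-normalizer in the change of relative entropy is a log moment generating
  function, hence its mean plus a variance term by Hoeffding's lemma.\<close>

lemma mu_update_regret:
  fixes M :: "('s, 'a) mdp" and g :: "'s \<times> 'a \<Rightarrow> real"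
  defines "Z \<equiv> states M \<times> actions M"
  assumes "finite (states M)" "finite (actions M)" "p \<in> sa_simplex M" "0 < \<eta>"
    and x: "\<And>z. z \<in> Z \<Longrightarrow> 0 \<le> x z" "\<And>z. z \<in> Z \<Longrightarrow> pmf p z = 0 \<Longrightarrow> x z = 0" "sum x Z = 1"
    and g: "\<And>z. z \<in> Z \<Longrightarrow> g z \<in> {a..b}"
  shows "(\<Sum>z\<in>Z. x z * ln (x z / pmf (\<mu>_update M \<eta> p g) z))
    \<le> (\<Sum>z\<in>Z. x z * ln (x z / pmf p z)) - \<eta> * (\<Sum>z\<in>Z. (x z - pmf p z) * g z)
      + \<eta>\<^sup>2 * (b - a)\<^sup>2 / 8"
proof -
  let ?W = "\<Sum>y\<in>Z. pmf p y * exp (\<eta> * g y)"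
  have Z: "finite Z" "set_pmf p \<subseteq> Z" using assms unfolding Z_def sa_simplex_def by auto
  have "(\<Sum>z\<in>Z. x z * ln (x z / (pmf p z * exp (\<eta> * g z) / ?W)))
    = (\<Sum>z\<in>Z. x z * ln (x z / pmf p z)) - \<eta> * (\<Sum>z\<in>Z. x z * g z) + ln ?W"
    by (rule relative_entropy_exp_weights) (use x mgf_pos[OF Z] in auto)
  then show ?thesis
    using log_mgf_le[OF Z g \<open>0 < \<eta>\<close>] pmf_mu_update(1)[OF assms(2-5), of g, folded Z_def]
    by (simp add: left_diff_distrib sum_subtractf right_diff_distrib)
qed

section \<open>The regularized proximal step\<close>

text \<open>Continuity refers to the product topology on functions. The set of states is generalized
  so that induction can split off one coordinate at a time.\<close>

lemma continuous_on_sup_norm: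
  assumes "finite (states M)" "states M \<noteq> {}"
  shows "continuous_on UNIV (sup_norm M)"
proof -
  have "continuous_on UNIV (\<lambda>v :: 's \<Rightarrow> real. Max ((\<lambda>s. \<bar>v s\<bar>) ` A))"
    if "finite A" "A \<noteq> {}" for A :: "'s set"
    using that
  proof (induction A rule: finite_ne_induct)
    case (singleton x)
    then show ?case by (auto intro!: continuous_intros)
  next
    case (insert x A)
    then have "Max ((\<lambda>s. \<bar>v s\<bar>) ` insert x A) = max \<bar>v x\<bar> (Max ((\<lambda>s. \<bar>v s\<bar>) ` A))"
      for v :: "'s \<Rightarrow> real" by simp
    then show ?case using insert.IH by (auto intro!: continuous_intros)
  qed
  then show ?thesis using assms unfolding sup_norm_def by blast
qed

lemma abs_le_sup_norm: "finite (states M) \<Longrightarrow> s \<in> states M \<Longrightarrow> \<bar>v s\<bar> \<le> sup_norm M v"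
  unfolding sup_norm_def by auto

lemma sup_norm_leI:
  assumes "finite (states M)" "states M \<noteq> {}" "\<And>s. s \<in> states M \<Longrightarrow> \<bar>v s\<bar> \<le> c"
  shows "sup_norm M v \<le> c"
  unfolding sup_norm_def using assms by auto

lemma sup_norm_nonneg: "finite (states M) \<Longrightarrow> states M \<noteq> {} \<Longrightarrow> 0 \<le> sup_norm M v"
  using abs_le_sup_norm[of M _ v] by (metis abs_ge_zero all_not_in_conv order_trans)

lemma sup_norm_cong: "(\<And>s. s \<in> states M \<Longrightarrow> u s = v s) \<Longrightarrow> sup_norm M u = sup_norm M v"
  unfolding sup_norm_def by (metis (no_types, lifting) image_cong)

lemma L2_set_squared: "(L2_set f A)\<^sup>2 = (\<Sum>i\<in>A. (f i)\<^sup>2)"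
  unfolding L2_set_def by (simp add: sum_nonneg)

context
  fixes M :: "('s, 'a) mdp" and \<eta> \<rho> :: real and v g :: "'s \<Rightarrow> real"
  assumes fin: "finite (states M)" "states M \<noteq> {}" and \<eta>: "0 < \<eta>" and \<rho>: "0 \<le> \<rho>"
begin

definition v_objective :: "('s \<Rightarrow> real) \<Rightarrow> real" where
  "v_objective w = (\<Sum>s\<in>states M. w s * g s) + 1 / (2 * \<eta>) * (\<Sum>s\<in>states M. (w s - v s)\<^sup>2)
     + \<rho> * (sup_norm M w)\<^sup>2"

text \<open>The form in which the effect of clipping can be read off: the middle sum does not depend
  on \<open>w\<close>.\<close>

lemma v_objective_complete_square:
  "v_objective w = (\<Sum>s\<in>states M. (w s - (v s - \<eta> * g s))\<^sup>2) / (2 * \<eta>)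
     + (\<Sum>s\<in>states M. v s * g s - \<eta> * (g s)\<^sup>2 / 2) + \<rho> * (sup_norm M w)\<^sup>2"
proof -
  have "w s * g s + 1 / (2 * \<eta>) * (w s - v s)\<^sup>2
      = (w s - (v s - \<eta> * g s))\<^sup>2 / (2 * \<eta>) + (v s * g s - \<eta> * (g s)\<^sup>2 / 2)" for s
    using \<eta> by (simp add: field_simps power2_eq_square)
  then show ?thesis
    unfolding v_objective_def sum_distrib_left sum_divide_distrib by (simp flip: sum.distrib)
qed

text \<open>Clipping to a box containing the unregularized minimizer decreases the objective, so the
  minimum over the compact box is global.\<close>

lemma v_objective_minimizer_exists:
  "\<exists>w\<in>state_vectors M. \<forall>u\<in>state_vectors M. v_objective w \<le> v_objective u"
proof -
  define m where "m s = v s - \<eta> * g s" for s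
  \<comment> \<open>The sum is merely a convenient common bound on the coordinates of
    \<open>m\<close>, the minimizer without regularization.\<close>
  define R where "R = (\<Sum>s\<in>states M. \<bar>m s\<bar>)"
  \<comment> \<open>Coordinates outside the states are pinned to 0, which makes the product over the
    whole type compact and a subset of \<open>state_vectors M\<close>.\<close>
  define K where "K = PiE UNIV (\<lambda>s. if s \<in> states M then {-R..R} else {0})"
  have R: "\<bar>m s\<bar> \<le> R" if "s \<in> states M" for s
    unfolding R_def using fin that by (intro member_le_sum) auto
  have "0 \<le> R" unfolding R_def by (simp add: sum_nonneg)
  have "compactin (product_topology (\<lambda>_. euclidean) UNIV) K"
    unfolding K_def compactin_PiE by auto
  then have "compact K" by (simp add: euclidean_product_topology)
  moreover have "K \<noteq> {}" unfolding K_def using \<open>0 \<le> R\<close> by (auto simp: PiE_eq_empty_iff)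
  moreover have "continuous_on K v_objective"
  proof -
    have coord: "continuous_on K (\<lambda>w. w s)" for s
      by (rule continuous_on_subset[OF continuous_on_product_coordinates subset_UNIV])
    have sup: "continuous_on K (\<lambda>w. sup_norm M w)"
      by (rule continuous_on_subset[OF continuous_on_sup_norm[OF fin] subset_UNIV])
    show ?thesis
      unfolding v_objective_def[abs_def] by (intro continuous_intros coord sup)
  qed
  ultimately obtain w where w: "w \<in> K" "\<And>u. u \<in> K \<Longrightarrow> v_objective w \<le> v_objective u"
    using continuous_attains_inf[of K v_objective] by blast
  have "v_objective w \<le> v_objective u" if u: "u \<in> state_vectors M" for u
  proof -
    define c where "c s = max (- R) (min R (u s))" for s
    have "c \<in> K" unfolding K_def using u \<open>0 \<le> R\<close> by (auto simp: c_def state_vectors_def)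
    then have "v_objective w \<le> v_objective c" by (rule w)
    also have "\<dots> \<le> v_objective u"
    proof -
      have "(c s - m s)\<^sup>2 \<le> (u s - m s)\<^sup>2" if "s \<in> states M" for s
        using R[OF that] unfolding c_def by (intro abs_le_square_iff[THEN iffD1]) auto
      then have "(\<Sum>s\<in>states M. (c s - m s)\<^sup>2) \<le> (\<Sum>s\<in>states M. (u s - m s)\<^sup>2)"
        by (rule sum_mono)
      moreover have "sup_norm M c \<le> sup_norm M u"
      proof (rule sup_norm_leI[OF fin])
        fix s assume "s \<in> states M"
        have "\<bar>c s\<bar> \<le> \<bar>u s\<bar>" using \<open>0 \<le> R\<close> unfolding c_def by auto
        then show "\<bar>c s\<bar> \<le> sup_norm M u"
          using abs_le_sup_norm[OF fin(1) \<open>s \<in> states M\<close>, of u] by linarith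
      qed
      then have "(sup_norm M c)\<^sup>2 \<le> (sup_norm M u)\<^sup>2"
        using sup_norm_nonneg[OF fin] by (intro power_mono)
      ultimately show ?thesis
        using \<eta> \<rho> unfolding v_objective_complete_square m_def
        by (intro add_mono divide_right_mono mult_left_mono) auto
    qed
    finally show ?thesis .
  qed
  moreover have "w \<in> state_vectors M"
    using w(1) unfolding K_def state_vectors_def by (auto simp: PiE_iff split: if_splits)
  ultimately show ?thesis by blast
qed

lemma v_update_minimal:
  shows "v_update M \<eta> \<rho> v g \<in> state_vectors M"
    and "u \<in> state_vectors M \<Longrightarrow> v_objective (v_update M \<eta> \<rho> v g) \<le> v_objective u"
proof -
  have eq: "v_update M \<eta> \<rho> v g = arg_min v_objective (\<lambda>w. w \<in> state_vectors M)"
    unfolding v_update_def arg_min_on_def v_objective_def L2_set_squared ..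
  obtain w where w: "w \<in> state_vectors M" "\<And>u. u \<in> state_vectors M \<Longrightarrow> v_objective w \<le> v_objective u"
    using v_objective_minimizer_exists by blast
  show "v_update M \<eta> \<rho> v g \<in> state_vectors M"
    unfolding eq by (rule arg_minI[of _ w]) (use w in \<open>auto simp: not_less\<close>)
  show "v_objective (v_update M \<eta> \<rho> v g) \<le> v_objective u" if "u \<in> state_vectors M"
    using w(2)[OF that] arg_min_equality[of "\<lambda>w. w \<in> state_vectors M" w v_objective] w
    unfolding eq by auto
qed

section \<open>Strong convexity of the objective and the regret of one proximal step\<close>

lemma sup_norm_segment:
  assumes "0 \<le> t" "t \<le> 1"
  shows "(sup_norm M (\<lambda>s. (1 - t) * w s + t * u s))\<^sup>2
    \<le> (1 - t) * (sup_norm M w)\<^sup>2 + t * (sup_norm M u)\<^sup>2"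
proof -
  let ?a = "sup_norm M w" and ?b = "sup_norm M u"
  have "sup_norm M (\<lambda>s. (1 - t) * w s + t * u s) \<le> (1 - t) * ?a + t * ?b"
  proof (rule sup_norm_leI[OF fin])
    fix s assume s: "s \<in> states M"
    have "\<bar>(1 - t) * w s + t * u s\<bar> \<le> (1 - t) * \<bar>w s\<bar> + t * \<bar>u s\<bar>"
      using assms by (intro abs_triangle_ineq[THEN order_trans]) (simp add: abs_mult)
    also have "\<dots> \<le> (1 - t) * ?a + t * ?b"
      using assms abs_le_sup_norm[OF fin(1) s] by (intro add_mono mult_left_mono) auto
    finally show "\<bar>(1 - t) * w s + t * u s\<bar> \<le> (1 - t) * ?a + t * ?b" .
  qed
  then have "(sup_norm M (\<lambda>s. (1 - t) * w s + t * u s))\<^sup>2 \<le> ((1 - t) * ?a + t * ?b)\<^sup>2"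
    using sup_norm_nonneg[OF fin] by (intro power_mono)
  also have "\<dots> = (1 - t) * ?a\<^sup>2 + t * ?b\<^sup>2 - t * (1 - t) * (?a - ?b)\<^sup>2"
    by (simp add: algebra_simps power2_eq_square)
  also have "\<dots> \<le> (1 - t) * ?a\<^sup>2 + t * ?b\<^sup>2" using assms by simp
  finally show ?thesis .
qed

text \<open>The linear and regularizing parts are convex; the quadratic part contributes the exact
  convexity defect, which gives strong convexity.\<close>

lemma v_objective_segment:
  assumes "0 \<le> t" "t \<le> 1"
  shows "v_objective (\<lambda>s. (1 - t) * w s + t * u s) \<le> (1 - t) * v_objective w + t * v_objective u
    - t * (1 - t) * ((\<Sum>s\<in>states M. (u s - w s)\<^sup>2) / (2 * \<eta>))"
proof -
  let ?z = "\<lambda>s. (1 - t) * w s + t * u s"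
  have lin: "(\<Sum>s\<in>states M. ?z s * g s)
      = (1 - t) * (\<Sum>s\<in>states M. w s * g s) + t * (\<Sum>s\<in>states M. u s * g s)"
    unfolding sum_distrib_left sum.distrib[symmetric] by (intro sum.cong) (auto simp: algebra_simps)
  have squares: "(\<Sum>s\<in>states M. (?z s - v s)\<^sup>2) = (1 - t) * (\<Sum>s\<in>states M. (w s - v s)\<^sup>2)
      + t * (\<Sum>s\<in>states M. (u s - v s)\<^sup>2) - t * (1 - t) * (\<Sum>s\<in>states M. (u s - w s)\<^sup>2)"
    unfolding sum_distrib_left sum.distrib[symmetric] sum_subtractf[symmetric]
    by (intro sum.cong) (auto simp: algebra_simps power2_eq_square)
  have quad: "1 / (2 * \<eta>) * (\<Sum>s\<in>states M. (?z s - v s)\<^sup>2)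
      = (1 - t) * (1 / (2 * \<eta>) * (\<Sum>s\<in>states M. (w s - v s)\<^sup>2))
      + t * (1 / (2 * \<eta>) * (\<Sum>s\<in>states M. (u s - v s)\<^sup>2))
      - t * (1 - t) * ((\<Sum>s\<in>states M. (u s - w s)\<^sup>2) / (2 * \<eta>))"
    unfolding squares by (simp add: algebra_simps diff_divide_distrib add_divide_distrib)
  have "\<rho> * (sup_norm M ?z)\<^sup>2 \<le> \<rho> * ((1 - t) * (sup_norm M w)\<^sup>2 + t * (sup_norm M u)\<^sup>2)"
    using sup_norm_segment[OF assms] \<rho> by (rule mult_left_mono)
  then show ?thesis unfolding v_objective_def lin quad by (simp add: algebra_simps)
qed

text \<open>The supremum norm is not differentiable, so there is no gradient condition at the
  minimizer. Instead the minimizer is compared with points on the segment towards \<open>u\<close>: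
  strong convexity gives the claim with the distance term shrunk by a factor \<open>z < 1\<close>,
  and \<open>z\<close> tends to 1.\<close>

lemma v_update_three_point:
  defines "w \<equiv> v_update M \<eta> \<rho> v g"
  assumes u: "u \<in> state_vectors M"
  shows "v_objective w + (\<Sum>s\<in>states M. (u s - w s)\<^sup>2) / (2 * \<eta>) \<le> v_objective u"
proof -
  let ?d = "(\<Sum>s\<in>states M. (u s - w s)\<^sup>2) / (2 * \<eta>)"
  have "z * ?d \<le> v_objective u - v_objective w" if "0 < z" "z < 1" for z
  proof -
    have "(\<lambda>s. (1 - (1 - z)) * w s + (1 - z) * u s) \<in> state_vectors M"
      using u v_update_minimal(1) unfolding w_def state_vectors_def by auto
    then have "v_objective w \<le> v_objective (\<lambda>s. (1 - (1 - z)) * w s + (1 - z) * u s)"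
      unfolding w_def by (rule v_update_minimal(2))
    also have "\<dots> \<le> z * v_objective w + (1 - z) * v_objective u - (1 - z) * z * ?d"
      using v_objective_segment[of "1 - z" w u] that by simp
    finally have "(1 - z) * (z * ?d) \<le> (1 - z) * (v_objective u - v_objective w)"
      by (simp add: algebra_simps)
    then show ?thesis by (rule mult_left_le_imp_le) (use that in simp)
  qed
  then have "?d \<le> v_objective u - v_objective w" by (rule field_le_mult_one_interval)
  then show ?thesis by simp
qed

text \<open>The three-point inequality evaluates \<open>g\<close> at the new point \<open>w\<close>,
  the regret at the old point \<open>v\<close>. Young's inequality bounds the difference by the
  squared length of \<open>g\<close> and a multiple of the squared move, which the proximal term
  cancels.\<close>

lemma v_update_regret:
  defines "w \<equiv> v_update M \<eta> \<rho> v g"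
  shows "(\<Sum>s\<in>states M. (v s - u s) * g s)
    \<le> (\<Sum>s\<in>states M. (u s - v s)\<^sup>2) / (2 * \<eta>) - (\<Sum>s\<in>states M. (u s - w s)\<^sup>2) / (2 * \<eta>)
      + \<eta> / 2 * (\<Sum>s\<in>states M. (g s)\<^sup>2) + \<rho> * (sup_norm M u)\<^sup>2 - \<rho> * (sup_norm M w)\<^sup>2"
proof -
  \<comment> \<open>The comparator must lie in \<open>state_vectors M\<close>, but a bias vector is
    not controlled outside the states.\<close>
  define u' where "u' s = (if s \<in> states M then u s else 0)" for s
  have sup: "sup_norm M u' = sup_norm M u" by (rule sup_norm_cong) (simp add: u'_def)
  have "u' \<in> state_vectors M" by (simp add: state_vectors_def u'_def)
  from v_update_three_point[OF this]
  have "(\<Sum>s\<in>states M. w s * g s) + 1 / (2 * \<eta>) * (\<Sum>s\<in>states M. (w s - v s)\<^sup>2)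
      + \<rho> * (sup_norm M w)\<^sup>2 + (\<Sum>s\<in>states M. (u s - w s)\<^sup>2) / (2 * \<eta>)
      \<le> (\<Sum>s\<in>states M. u s * g s) + 1 / (2 * \<eta>) * (\<Sum>s\<in>states M. (u s - v s)\<^sup>2)
      + \<rho> * (sup_norm M u)\<^sup>2"
    unfolding v_objective_def w_def[symmetric] sup by (simp add: u'_def cong: sum.cong)
  moreover have "(\<Sum>s\<in>states M. (v s - w s) * g s)
      \<le> \<eta> / 2 * (\<Sum>s\<in>states M. (g s)\<^sup>2) + 1 / (2 * \<eta>) * (\<Sum>s\<in>states M. (w s - v s)\<^sup>2)"
  proof -
    have "(v s - w s) * g s \<le> \<eta> / 2 * (g s)\<^sup>2 + 1 / (2 * \<eta>) * (w s - v s)\<^sup>2" for s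
    proof -
      have "0 \<le> (\<eta> * g s + (w s - v s))\<^sup>2 / (2 * \<eta>)" using \<eta> by simp
      also have "\<dots> = \<eta> / 2 * (g s)\<^sup>2 + 1 / (2 * \<eta>) * (w s - v s)\<^sup>2 - (v s - w s) * g s"
        using \<eta> by (simp add: field_simps power2_eq_square)
      finally show ?thesis by simp
    qed
    then show ?thesis
      unfolding sum_distrib_left sum.distrib[symmetric] by (rule sum_mono)
  qed
  ultimately show ?thesis by (simp add: left_diff_distrib sum_subtractf)
qed

end

section \<open>Stationary distribution and bias\<close>

locale ergodic_mdp =
  fixes M :: "('s, 'a) mdp"
  assumes average_reward_mdp: "average_reward_mdp M"
begin

abbreviation "S \<equiv> states M"
abbreviation "A \<equiv> actions M"
abbreviation "P \<equiv> trans_prob M"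

lemma finite_states: "finite S" and states_ne: "S \<noteq> {}"
  and finite_actions: "finite A" and actions_ne: "A \<noteq> {}"
  using average_reward_mdp unfolding average_reward_mdp_def by blast+

lemma reward_bounds: "s \<in> S \<Longrightarrow> a \<in> A \<Longrightarrow> 0 \<le> reward M s a \<and> reward M s a \<le> 1"
  and set_trans: "s \<in> S \<Longrightarrow> a \<in> A \<Longrightarrow> set_pmf (P s a) \<subseteq> S"
  using average_reward_mdp unfolding average_reward_mdp_def by blast+

lemma set_policy: "\<pi> \<in> policies M \<Longrightarrow> s \<in> S \<Longrightarrow> set_pmf (\<pi> s) \<subseteq> A"
  unfolding policies_def by blast

lemma sum_trans: "s \<in> S \<Longrightarrow> a \<in> A \<Longrightarrow> (\<Sum>s'\<in>S. pmf (P s a) s') = 1"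
  by (intro sum_pmf_eq_1 finite_states set_trans)

lemma sum_policy: "\<pi> \<in> policies M \<Longrightarrow> s \<in> S \<Longrightarrow> (\<Sum>a\<in>A. pmf (\<pi> s) a) = 1"
  by (intro sum_pmf_eq_1 finite_actions set_policy)

definition kernel :: "('s \<Rightarrow> 'a pmf) \<Rightarrow> 's \<Rightarrow> 's \<Rightarrow> real" where
  "kernel \<pi> s s' = (\<Sum>a\<in>A. pmf (\<pi> s) a * pmf (P s a) s')"

lemma sum_kernel_mult:
  "(\<Sum>s'\<in>S. kernel \<pi> s s' * f s') = (\<Sum>a\<in>A. pmf (\<pi> s) a * (\<Sum>s'\<in>S. pmf (P s a) s' * f s'))"
  unfolding kernel_def sum_distrib_left sum_distrib_right
  by (subst sum.swap) (simp add: mult.assoc)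

lemma sum_kernel: "\<pi> \<in> policies M \<Longrightarrow> s \<in> S \<Longrightarrow> (\<Sum>s'\<in>S. kernel \<pi> s s') = 1"
  using sum_kernel_mult[of \<pi> s "\<lambda>_. 1"] by (simp add: sum_trans sum_policy)

section \<open>Expected totals and visit counts along trajectories\<close>

lemma trajectory_support:
  assumes "\<pi> \<in> policies M" "s \<in> S"
  shows "set_pmf (trajectory M \<pi> K s) \<subseteq> {\<tau>. set \<tau> \<subseteq> S \<times> A \<and> length \<tau> = K}"
  using assms(2)
proof (induction K arbitrary: s)
  case (Suc K)
  show ?case
  proof
    fix \<tau> assume "\<tau> \<in> set_pmf (trajectory M \<pi> (Suc K) s)"
    then obtain a s' \<tau>' where "a \<in> set_pmf (\<pi> s)" "s' \<in> set_pmf (P s a)"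
      "\<tau>' \<in> set_pmf (trajectory M \<pi> K s')" "\<tau> = (s, a) # \<tau>'" by auto
    moreover from this have "a \<in> A" "s' \<in> S"
      using set_policy[OF assms(1) Suc.prems] set_trans[OF Suc.prems] by auto
    ultimately show "\<tau> \<in> {\<tau>. set \<tau> \<subseteq> S \<times> A \<and> length \<tau> = Suc K}"
      using Suc.IH[of s'] Suc.prems by auto
  qed
qed simp

lemma finite_trajectory:
  "\<pi> \<in> policies M \<Longrightarrow> s \<in> S \<Longrightarrow> finite (set_pmf (trajectory M \<pi> K s))"
  by (rule finite_subset[OF trajectory_support])
    (auto intro: finite_lists_length_eq finite_states finite_actions)

text \<open>Visit counts, reward sums and partial biases are all instances, so that one recursion
  serves all three.\<close>

definition total :: "('s \<Rightarrow> 'a pmf) \<Rightarrow> ('s \<Rightarrow> 'a \<Rightarrow> real) \<Rightarrow> nat \<Rightarrow> 's \<Rightarrow> real" where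
  "total \<pi> f K s = measure_pmf.expectation (trajectory M \<pi> K s) (\<lambda>\<tau>. \<Sum>(s, a)\<leftarrow>\<tau>. f s a)"

lemma total_0 [simp]: "total \<pi> f 0 s = 0"
  by (simp add: total_def)

lemma total_Suc:
  assumes \<pi>: "\<pi> \<in> policies M" and s: "s \<in> S"
  shows "total \<pi> f (Suc K) s = (\<Sum>a\<in>A. pmf (\<pi> s) a * f s a) + (\<Sum>s'\<in>S. kernel \<pi> s s' * total \<pi> f K s')"
proof -
  have cons: "measure_pmf.expectation (map_pmf ((#) (s, a)) (trajectory M \<pi> K s')) (\<lambda>\<tau>. \<Sum>(s, a)\<leftarrow>\<tau>. f s a)
      = f s a + total \<pi> f K s'" if "s' \<in> S" for s' a
    using finite_trajectory[OF \<pi> that, of K]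
    by (simp add: total_def integrable_measure_pmf_finite)
  have "measure_pmf.expectation (bind_pmf (P s a) (\<lambda>s'. map_pmf ((#) (s, a)) (trajectory M \<pi> K s')))
        (\<lambda>\<tau>. \<Sum>(s, a)\<leftarrow>\<tau>. f s a) = (\<Sum>s'\<in>S. pmf (P s a) s' * (f s a + total \<pi> f K s'))"
    if "a \<in> A" for a
    by (subst pmf_expectation_bind[of S])
      (use set_trans[OF s that] finite_states finite_trajectory[OF \<pi>] cons in auto)
  moreover have "(\<Sum>s'\<in>S. pmf (P s a) s' * (f s a + total \<pi> f K s'))
      = f s a + (\<Sum>s'\<in>S. pmf (P s a) s' * total \<pi> f K s')" if "a \<in> A" for a
    using sum_trans[OF s that] by (simp add: distrib_left sum.distrib flip: sum_distrib_right)
  moreover have "finite (set_pmf (bind_pmf (P s a)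
      (\<lambda>s'. map_pmf ((#) (s, a)) (trajectory M \<pi> K s'))))" if "a \<in> A" for a
    using set_trans[OF s that] finite_trajectory[OF \<pi>, of _ K] finite_subset[OF _ finite_states] by auto
  ultimately have "total \<pi> f (Suc K) s
      = (\<Sum>a\<in>A. pmf (\<pi> s) a * (f s a + (\<Sum>s'\<in>S. pmf (P s a) s' * total \<pi> f K s')))"
    unfolding total_def[of \<pi> f "Suc K"] trajectory.simps
    by (subst pmf_expectation_bind[of A]) (use set_policy[OF \<pi> s] finite_actions in auto)
  then show ?thesis
    unfolding sum_kernel_mult by (simp add: distrib_left sum.distrib)
qed

definition visits :: "('s \<Rightarrow> 'a pmf) \<Rightarrow> nat \<Rightarrow> 's \<Rightarrow> 's \<Rightarrow> real" where
  "visits \<pi> K s x = total \<pi> (\<lambda>s a. of_bool (s = x)) K s"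

lemma visits_0 [simp]: "visits \<pi> 0 s x = 0"
  by (simp add: visits_def)

lemma visits_Suc:
  assumes "\<pi> \<in> policies M" "s \<in> S"
  shows "visits \<pi> (Suc K) s x = of_bool (s = x) + (\<Sum>s'\<in>S. kernel \<pi> s s' * visits \<pi> K s' x)"
  using sum_policy[OF assms] unfolding visits_def total_Suc[OF assms]
  by (simp flip: sum_distrib_right)

lemma visit_freq_eq:
  assumes "\<pi> \<in> policies M" "s \<in> S"
  shows "visit_freq M \<pi> s K x = visits \<pi> K s x / real K"
proof -
  let ?t = "trajectory M \<pi> K s"
  note fin = finite_trajectory[OF assms, of K]
  have "(\<Sum>k<K. measure_pmf.prob ?t {\<tau>. fst (\<tau> ! k) = x})
      = (\<Sum>k<K. measure_pmf.expectation ?t (\<lambda>\<tau>. of_bool (fst (\<tau> ! k) = x)))"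
  proof (intro sum.cong refl)
    fix k
    have "measure_pmf.prob ?t {\<tau>. fst (\<tau> ! k) = x}
        = measure_pmf.expectation ?t (indicator {\<tau>. fst (\<tau> ! k) = x})"
      by simp
    also have "\<dots> = measure_pmf.expectation ?t (\<lambda>\<tau>. of_bool (fst (\<tau> ! k) = x))"
      by (intro Bochner_Integration.integral_cong) (auto simp: indicator_def)
    finally show "measure_pmf.prob ?t {\<tau>. fst (\<tau> ! k) = x}
        = measure_pmf.expectation ?t (\<lambda>\<tau>. of_bool (fst (\<tau> ! k) = x))" .
  qed
  also have "\<dots> = measure_pmf.expectation ?t (\<lambda>\<tau>. \<Sum>k<K. of_bool (fst (\<tau> ! k) = x))"
    by (rule Bochner_Integration.integral_sum[symmetric])
      (rule integrable_measure_pmf_finite[OF fin])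
  also have "\<dots> = visits \<pi> K s x"
    unfolding visits_def total_def
  proof (intro integral_cong_AE)
    \<comment> \<open>On the support the list has length exactly \<open>K\<close>, so no access
      \<open>\<tau> ! k\<close> is out of range.\<close>
    show "AE \<tau> in ?t. (\<Sum>k<K. of_bool (fst (\<tau> ! k) = x) :: real) = (\<Sum>(s, a)\<leftarrow>\<tau>. of_bool (s = x))"
      using trajectory_support[OF assms, of K]
      by (auto simp: AE_measure_pmf_iff sum_list_sum_nth atLeast0LessThan case_prod_beta
          intro!: sum.cong)
  qed auto
  finally show ?thesis unfolding visit_freq_def by simp
qed

text \<open>Given the current state, the action is a fresh draw from the policy, so \<open>f\<close>
  enters only through its average over actions.\<close>

lemma total_eq_visits:
  assumes "\<pi> \<in> policies M" "s \<in> S"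
  shows "total \<pi> f K s = (\<Sum>x\<in>S. visits \<pi> K s x * (\<Sum>a\<in>A. pmf (\<pi> x) a * f x a))"
  using assms(2)
proof (induction K arbitrary: s)
  case (Suc K)
  let ?f = "\<lambda>x. \<Sum>a\<in>A. pmf (\<pi> x) a * f x a"
  have "(\<Sum>x\<in>S. visits \<pi> (Suc K) s x * ?f x)
      = (\<Sum>x\<in>S. of_bool (s = x) * ?f x) + (\<Sum>x\<in>S. (\<Sum>s'\<in>S. kernel \<pi> s s' * visits \<pi> K s' x) * ?f x)"
    unfolding visits_Suc[OF assms(1) Suc.prems] by (simp only: distrib_right sum.distrib)
  also have "(\<Sum>x\<in>S. of_bool (s = x) * ?f x) = ?f s"
    using Suc.prems finite_states by simp
  also have "(\<Sum>x\<in>S. (\<Sum>s'\<in>S. kernel \<pi> s s' * visits \<pi> K s' x) * ?f x)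
      = (\<Sum>s'\<in>S. kernel \<pi> s s' * (\<Sum>x\<in>S. visits \<pi> K s' x * ?f x))"
    unfolding sum_distrib_right[where ?r = "?f _"] by (subst sum.swap) (simp add: sum_distrib_left mult.assoc)
  also have "\<dots> = (\<Sum>s'\<in>S. kernel \<pi> s s' * total \<pi> f K s')"
    using Suc.IH by simp
  finally show ?case by (simp add: total_Suc[OF assms(1) Suc.prems])
qed simp

text \<open>Trajectories unfold at the first step, whereas invariance of the limit needs unfolding
  at the last step. In matrix form the induction turns \<open>I + P N\<close> into
  \<open>I + N P\<close>: the visit matrix is a polynomial in the kernel and commutes with
  it.\<close>

lemma visits_forward:
  assumes "\<pi> \<in> policies M" "s \<in> S" "x \<in> S"
  shows "visits \<pi> (Suc K) s x = of_bool (s = x) + (\<Sum>y\<in>S. visits \<pi> K s y * kernel \<pi> y x)"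
  using assms(2)
proof (induction K arbitrary: s)
  case 0
  then show ?case by (simp add: visits_Suc[OF assms(1)])
next
  case (Suc K)
  have "visits \<pi> (Suc (Suc K)) s x = of_bool (s = x)
      + (\<Sum>y\<in>S. kernel \<pi> s y * (of_bool (y = x) + (\<Sum>z\<in>S. visits \<pi> K y z * kernel \<pi> z x)))"
    using Suc.IH by (simp add: visits_Suc[OF assms(1) Suc.prems, of "Suc K"])
  also have "(\<Sum>y\<in>S. kernel \<pi> s y * (of_bool (y = x) + (\<Sum>z\<in>S. visits \<pi> K y z * kernel \<pi> z x)))
      = kernel \<pi> s x + (\<Sum>y\<in>S. \<Sum>z\<in>S. kernel \<pi> s y * visits \<pi> K y z * kernel \<pi> z x)"
    using assms(3) finite_states by (simp add: distrib_left sum.distrib sum_distrib_left mult.assoc)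
  also have "(\<Sum>y\<in>S. \<Sum>z\<in>S. kernel \<pi> s y * visits \<pi> K y z * kernel \<pi> z x)
      = (\<Sum>z\<in>S. (\<Sum>y\<in>S. kernel \<pi> s y * visits \<pi> K y z) * kernel \<pi> z x)"
    by (subst sum.swap) (simp add: sum_distrib_right)
  also have "kernel \<pi> s x + \<dots> = (\<Sum>z\<in>S. visits \<pi> (Suc K) s z * kernel \<pi> z x)"
    using Suc.prems finite_states
    by (simp add: visits_Suc[OF assms(1) Suc.prems] distrib_right sum.distrib)
  finally show ?case .
qed

lemma sum_visits:
  assumes "\<pi> \<in> policies M" "s \<in> S"
  shows "(\<Sum>x\<in>S. visits \<pi> K s x) = real K"
proof -
  have "total \<pi> (\<lambda>_ _. 1) K s = real K"
    using assms(2)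
  proof (induction K arbitrary: s)
    case (Suc K)
    then show ?case
      using total_Suc[OF assms(1) Suc.prems, of "\<lambda>_ _. 1" K] sum_kernel[OF assms(1) Suc.prems]
      by (simp add: sum_policy[OF assms(1)] flip: sum_distrib_right)
  qed simp
  then show ?thesis
    using total_eq_visits[OF assms, of "\<lambda>_ _. 1" K] by (simp add: sum_policy[OF assms(1)])
qed

section \<open>Stationary distributions, occupancies and the Bellman equation as limits\<close>

lemma visits_limit:
  assumes "\<pi> \<in> policies M" "s \<in> S"
  shows "(\<lambda>K. visits \<pi> K s x / real K) \<longlonglongrightarrow> stationary_dist M \<pi> x"
proof -
  have "\<exists>!\<nu>. is_stationary_dist M \<pi> \<nu>"
    using average_reward_mdp assms(1) unfolding average_reward_mdp_def by blast
  then have "is_stationary_dist M \<pi> (stationary_dist M \<pi>)"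
    unfolding stationary_dist_def by (rule theI')
  then have "(\<lambda>K. visit_freq M \<pi> s K x) \<longlonglongrightarrow> stationary_dist M \<pi> x"
    using assms(2) unfolding is_stationary_dist_def by blast
  then show ?thesis by (simp add: visit_freq_eq[OF assms])
qed

lemma stationary_nonneg:
  assumes "\<pi> \<in> policies M"
  shows "0 \<le> stationary_dist M \<pi> x"
proof -
  obtain s where s: "s \<in> S" using states_ne by blast
  have "0 \<le> visits \<pi> K s x / real K" for K
    unfolding visits_def total_def
    by (intro divide_nonneg_nonneg Bochner_Integration.integral_nonneg sum_list_nonneg) auto
  then show ?thesis using visits_limit[OF assms s, of x] by (intro LIMSEQ_le_const) auto
qed

lemma sum_stationary:
  assumes "\<pi> \<in> policies M"
  shows "(\<Sum>x\<in>S. stationary_dist M \<pi> x) = 1"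
proof -
  obtain s where s: "s \<in> S" using states_ne by blast
  have "(\<lambda>K. \<Sum>x\<in>S. visits \<pi> K s x / real K) \<longlonglongrightarrow> (\<Sum>x\<in>S. stationary_dist M \<pi> x)"
    by (intro tendsto_sum visits_limit[OF assms s])
  moreover have "eventually (\<lambda>K. (\<Sum>x\<in>S. visits \<pi> K s x / real K) = 1) sequentially"
    using eventually_gt_at_top[of 0]
    by eventually_elim (simp add: sum_visits[OF assms s] flip: sum_divide_distrib)
  then have "(\<lambda>K. \<Sum>x\<in>S. visits \<pi> K s x / real K) \<longlonglongrightarrow> 1" by (rule tendsto_eventually)
  ultimately show ?thesis by (rule LIMSEQ_unique)
qed

text \<open>Divide the forward recursion by the number of steps and pass to the limit: the initial
  visit becomes negligible, and the mismatch between \<open>K\<close> and \<open>Suc K\<close> tends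
  to the factor 1.\<close>

lemma stationary_invariant:
  assumes "\<pi> \<in> policies M" "x \<in> S"
  shows "(\<Sum>y\<in>S. stationary_dist M \<pi> y * kernel \<pi> y x) = stationary_dist M \<pi> x"
proof -
  obtain s where s: "s \<in> S" using states_ne by blast
  have "visits \<pi> (Suc K) s x / real (Suc K) = of_bool (s = x) * inverse (real (Suc K))
      + (\<Sum>y\<in>S. visits \<pi> K s y / real K * (real K / real (Suc K)) * kernel \<pi> y x)" for K
  proof -
    have "visits \<pi> K s y / real K * (real K / real (Suc K)) = visits \<pi> K s y / real (Suc K)" for y
      by (cases "K = 0") auto
    then show ?thesis
      unfolding visits_forward[OF assms(1) s assms(2)]
      by (simp add: add_divide_distrib sum_divide_distrib divide_inverse[of "of_bool _"])
  qed
  moreover have "(\<lambda>K. of_bool (s = x) * inverse (real (Suc K))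
      + (\<Sum>y\<in>S. visits \<pi> K s y / real K * (real K / real (Suc K)) * kernel \<pi> y x))
    \<longlonglongrightarrow> of_bool (s = x) * 0 + (\<Sum>y\<in>S. stationary_dist M \<pi> y * 1 * kernel \<pi> y x)"
    by (intro tendsto_intros visits_limit[OF assms(1) s] LIMSEQ_n_over_Suc_n
        LIMSEQ_inverse_real_of_nat)
  moreover have "(\<lambda>K. visits \<pi> (Suc K) s x / real (Suc K)) \<longlonglongrightarrow> stationary_dist M \<pi> x"
    by (rule LIMSEQ_Suc[OF visits_limit[OF assms(1) s]])
  ultimately show ?thesis using LIMSEQ_unique by fastforce
qed

lemma occupancy_nonneg: "\<pi> \<in> policies M \<Longrightarrow> 0 \<le> occupancy M \<pi> z"
  unfolding occupancy_def by (auto simp: stationary_nonneg split: prod.splits)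

lemma sum_occupancy_mult:
  assumes "\<pi> \<in> policies M"
  shows "(\<Sum>z\<in>S \<times> A. occupancy M \<pi> z * f z)
    = (\<Sum>s\<in>S. stationary_dist M \<pi> s * (\<Sum>a\<in>A. pmf (\<pi> s) a * f (s, a)))"
  unfolding occupancy_def sum.cartesian_product'
  by (simp add: sum_distrib_left mult_ac)

lemma sum_occupancy: "\<pi> \<in> policies M \<Longrightarrow> (\<Sum>z\<in>S \<times> A. occupancy M \<pi> z) = 1"
  using sum_occupancy_mult[of \<pi> "\<lambda>_. 1"] by (simp add: sum_policy sum_stationary)

text \<open>In stationarity the state has the same law before and after a transition, so no function
  \<open>v\<close> changes on average. This removes the iterate \<open>v\<close> from the
  comparator's side of the duality gap.\<close>

lemma occupancy_balance:
  assumes "\<pi> \<in> policies M"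
  shows "(\<Sum>(s, a)\<in>S \<times> A. occupancy M \<pi> (s, a) * ((\<Sum>s'\<in>S. pmf (P s a) s' * v s') - v s)) = 0"
proof -
  let ?\<nu> = "stationary_dist M \<pi>"
  have "(\<Sum>(s, a)\<in>S \<times> A. occupancy M \<pi> (s, a) * ((\<Sum>s'\<in>S. pmf (P s a) s' * v s') - v s))
      = (\<Sum>s\<in>S. ?\<nu> s * (\<Sum>a\<in>A. pmf (\<pi> s) a * ((\<Sum>s'\<in>S. pmf (P s a) s' * v s') - v s)))"
    using sum_occupancy_mult[OF assms, of "\<lambda>(s, a). (\<Sum>s'\<in>S. pmf (P s a) s' * v s') - v s"]
    by (simp add: case_prod_beta)
  also have "\<dots> = (\<Sum>s\<in>S. ?\<nu> s * ((\<Sum>s'\<in>S. kernel \<pi> s s' * v s') - v s))"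
    unfolding sum_kernel_mult
    by (intro sum.cong refl)
      (simp add: right_diff_distrib sum_subtractf sum_policy[OF assms] flip: sum_distrib_right)
  also have "\<dots> = (\<Sum>s'\<in>S. (\<Sum>s\<in>S. ?\<nu> s * kernel \<pi> s s') * v s') - (\<Sum>s\<in>S. ?\<nu> s * v s)"
    unfolding right_diff_distrib sum_subtractf sum_distrib_left sum_distrib_right
    by (subst sum.swap) (simp add: mult.assoc)
  also have "\<dots> = 0" by (simp add: stationary_invariant[OF assms])
  finally show ?thesis .
qed

text \<open>The visit frequencies converge, so the limsup is a limit. The right-hand side is free of
  \<open>s\<close>, which allows the initial state to be exchanged later on.\<close>

lemma avg_reward_eq:
  assumes "\<pi> \<in> policies M" "s \<in> S"
  shows "avg_reward M \<pi> s = sa_inner M (occupancy M \<pi>) (\<lambda>(s, a). reward M s a)"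
proof -
  let ?r = "\<lambda>x. \<Sum>a\<in>A. pmf (\<pi> x) a * reward M x a"
  have "(\<lambda>K. total \<pi> (reward M) K s / real K) \<longlonglongrightarrow> (\<Sum>x\<in>S. stationary_dist M \<pi> x * ?r x)"
  proof -
    have "(\<lambda>K. \<Sum>x\<in>S. visits \<pi> K s x / real K * ?r x) \<longlonglongrightarrow> (\<Sum>x\<in>S. stationary_dist M \<pi> x * ?r x)"
      by (intro tendsto_intros visits_limit assms)
    then show ?thesis unfolding total_eq_visits[OF assms] sum_divide_distrib by simp
  qed
  then have "(\<lambda>K. ereal (total \<pi> (reward M) K s / real K)) \<longlonglongrightarrow> ereal (\<Sum>x\<in>S. stationary_dist M \<pi> x * ?r x)"
    by simp
  then have "limsup (\<lambda>K. ereal (total \<pi> (reward M) K s / real K)) = ereal (\<Sum>x\<in>S. stationary_dist M \<pi> x * ?r x)"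
    by (intro lim_imp_Limsup) auto
  then show ?thesis
    using sum_occupancy_mult[OF assms(1), of "\<lambda>(s, a). reward M s a"]
    unfolding avg_reward_def total_def sa_inner_def by simp
qed

lemma suboptimality_eq:
  assumes "\<pi> \<in> policies M" "\<pi>' \<in> policies M" "s \<in> S"
  shows "suboptimality M \<pi>' \<pi> = avg_reward M \<pi>' s - avg_reward M \<pi> s"
  unfolding suboptimality_def avg_reward_eq[OF assms(1,3)] avg_reward_eq[OF assms(2,3)] sa_inner_def
  by (simp add: left_diff_distrib sum_subtractf)

text \<open>The limit of the first-step recursion. Each partial bias subtracts the average reward of
  its own initial state, so the recursion connects different states only because that reward is the
  same for all of them.\<close>

lemma bellman_equation:
  assumes \<pi>: "\<pi> \<in> policies M" and s: "s \<in> S"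
  shows "bias M \<pi> s = (\<Sum>a\<in>A. pmf (\<pi> s) a *
    (reward M s a - avg_reward M \<pi> s + (\<Sum>s'\<in>S. pmf (P s a) s' * bias M \<pi> s')))"
proof -
  define f where "f x a = reward M x a - avg_reward M \<pi> s" for x a
  have "partial_bias M \<pi> x K = total \<pi> f K x" if "x \<in> S" for x K
    unfolding partial_bias_def total_def f_def avg_reward_eq[OF \<pi> that] avg_reward_eq[OF \<pi> s] ..
  moreover have "partial_bias M \<pi> x \<longlonglongrightarrow> bias M \<pi> x" if "x \<in> S" for x
    using average_reward_mdp \<pi> that unfolding average_reward_mdp_def bias_def
    by (simp add: convergent_LIMSEQ_iff)
  ultimately have lim: "(\<lambda>K. total \<pi> f K x) \<longlonglongrightarrow> bias M \<pi> x" if "x \<in> S" for x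
    using that by (metis (mono_tags, lifting) tendsto_cong eventually_sequentiallyI)
  have "(\<lambda>K. total \<pi> f (Suc K) s)
      \<longlonglongrightarrow> (\<Sum>a\<in>A. pmf (\<pi> s) a * f s a) + (\<Sum>s'\<in>S. kernel \<pi> s s' * bias M \<pi> s')"
    unfolding total_Suc[OF \<pi> s] by (intro tendsto_intros lim)
  then have "bias M \<pi> s = (\<Sum>a\<in>A. pmf (\<pi> s) a * f s a) + (\<Sum>s'\<in>S. kernel \<pi> s s' * bias M \<pi> s')"
    using LIMSEQ_Suc[OF lim[OF s]] LIMSEQ_unique by blast
  then show ?thesis
    unfolding f_def sum_kernel_mult by (simp add: distrib_left sum.distrib)
qed

end

section \<open>Regret of the two players\<close>

lemma expectation_bind_le:
  assumes "finite (set_pmf p)" "\<And>x. x \<in> set_pmf p \<Longrightarrow> finite (set_pmf (f x))"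
    "\<And>x. x \<in> set_pmf p \<Longrightarrow> measure_pmf.expectation (f x) F \<le> h x"
  shows "measure_pmf.expectation (bind_pmf p f) F \<le> measure_pmf.expectation p (h :: _ \<Rightarrow> real)"
  using assms
  by (subst pmf_expectation_bind[of "set_pmf p"])
    (auto simp: expectation_finite_support[of "set_pmf p"] intro!: sum_mono mult_left_mono)

context ergodic_mdp
begin

section \<open>Sampled gradients, their means and their size\<close>

abbreviation "Z \<equiv> S \<times> A"

text \<open>The v-gradient depends only on the state and its successor, so the action is
  forgotten.\<close>

definition transition_sample :: "('s \<times> 'a) pmf \<Rightarrow> ('s \<times> 's) pmf" where
  "transition_sample p = bind_pmf p (\<lambda>(s, a). map_pmf (Pair s) (P s a))"

definition successor_sample :: "('s \<times> 'a \<Rightarrow> 's) pmf" where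
  "successor_sample = Pi_pmf Z undefined (\<lambda>(x, b). P x b)"

definition v_gradient_sample :: "'s \<Rightarrow> 's \<Rightarrow> 's \<Rightarrow> real" where
  "v_gradient_sample s s' x = of_bool (x = s') - of_bool (x = s)"

definition v_gradient :: "('s \<times> 'a) pmf \<Rightarrow> 's \<Rightarrow> real" where
  "v_gradient p x = (\<Sum>(s, a)\<in>Z. pmf p (s, a) * (pmf (P s a) x - of_bool (x = s)))"

definition mu_gradient_sample :: "('s \<Rightarrow> real) \<Rightarrow> ('s \<times> 'a \<Rightarrow> 's) \<Rightarrow> 's \<times> 'a \<Rightarrow> real" where
  "mu_gradient_sample v sbar = (\<lambda>(s, a). reward M s a + v (sbar (s, a)) - v s)"

definition mu_gradient :: "('s \<Rightarrow> real) \<Rightarrow> 's \<times> 'a \<Rightarrow> real" where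
  "mu_gradient v = (\<lambda>(s, a). reward M s a + (\<Sum>s'\<in>S. pmf (P s a) s' * v s') - v s)"

lemma finite_Z: "finite Z" using finite_states finite_actions by simp

lemma set_simplex: "p \<in> sa_simplex M \<Longrightarrow> set_pmf p \<subseteq> Z"
  unfolding sa_simplex_def by simp

lemma set_transition_sample: "p \<in> sa_simplex M \<Longrightarrow> set_pmf (transition_sample p) \<subseteq> S \<times> S"
  unfolding transition_sample_def using set_simplex set_trans by fastforce

lemma successor_sample_in_S:
  "sbar \<in> set_pmf successor_sample \<Longrightarrow> z \<in> Z \<Longrightarrow> sbar z \<in> S"
  using set_trans finite_Z
  unfolding successor_sample_def by (fastforce simp: set_Pi_pmf PiE_dflt_def)

lemma finite_successor_sample: "finite (set_pmf successor_sample)"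
  unfolding successor_sample_def set_Pi_pmf[OF finite_Z]
  using set_trans finite_subset[OF _ finite_states] finite_Z
  by (intro finite_PiE_dflt) auto

lemma expectation_transition_sample:
  assumes "p \<in> sa_simplex M"
  shows "measure_pmf.expectation (transition_sample p) \<phi>
    = (\<Sum>(s, a)\<in>Z. pmf p (s, a) * (\<Sum>s'\<in>S. pmf (P s a) s' * (\<phi> (s, s') :: real)))"
proof -
  have "finite (set_pmf (P s a))" if "s \<in> S" "a \<in> A" for s a
    using set_trans[OF that] finite_states finite_subset by blast
  moreover have "measure_pmf.expectation (P s a) (\<lambda>s'. \<phi> (s, s')) = (\<Sum>s'\<in>S. pmf (P s a) s' * \<phi> (s, s'))"
    if "s \<in> S" "a \<in> A" for s a
    using set_trans[OF that] finite_states by (intro expectation_finite_support)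
  ultimately show ?thesis
    unfolding transition_sample_def
    by (subst pmf_expectation_bind[of Z])
      (use finite_Z set_simplex[OF assms] in \<open>auto intro!: sum.cong\<close>)
qed

text \<open>The weights \<open>c\<close> have to be fixed before the sample is drawn; a comparator
  determined by the rest of the run does not qualify.\<close>

lemma v_gradient_mean_zero:
  assumes p: "p \<in> sa_simplex M"
  shows "measure_pmf.expectation (transition_sample p)
    (\<lambda>(s, s'). \<Sum>x\<in>S. c x * (v_gradient p x - v_gradient_sample s s' x)) = 0"
proof -
  have unbiased: "measure_pmf.expectation (transition_sample p) (\<lambda>(s, s'). v_gradient_sample s s' x)
      = v_gradient p x" if "x \<in> S" for x
  proof -
    have "(\<Sum>s'\<in>S. pmf (P s a) s' * v_gradient_sample s s' x) = pmf (P s a) x - of_bool (x = s)"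
      if "s \<in> S" "a \<in> A" for s a
      using \<open>x \<in> S\<close> sum_trans[OF that] finite_states unfolding v_gradient_sample_def
      by (simp add: right_diff_distrib sum_subtractf flip: sum_distrib_right)
    then show ?thesis
      unfolding expectation_transition_sample[OF p] v_gradient_def by (auto intro!: sum.cong)
  qed
  have int: "integrable (transition_sample p) f" for f :: "_ \<Rightarrow> real"
    by (rule integrable_measure_pmf_finite)
      (use set_transition_sample[OF p] finite_states finite_subset in blast)
  have "measure_pmf.expectation (transition_sample p)
      (\<lambda>\<omega>. \<Sum>x\<in>S. c x * (v_gradient p x - (case \<omega> of (s, s') \<Rightarrow> v_gradient_sample s s' x)))
    = (\<Sum>x\<in>S. c x * (v_gradient p x
        - measure_pmf.expectation (transition_sample p) (\<lambda>(s, s'). v_gradient_sample s s' x)))"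
    using int by (simp add: Bochner_Integration.integral_diff)
  also have "\<dots> = 0" using unbiased by simp
  finally show ?thesis by (simp add: case_prod_unfold)
qed

text \<open>By linearity only the marginals of the product law matter, and the marginal at
  \<open>(s, a)\<close> is the transition law there.\<close>

lemma mu_gradient_mean_zero:
  "measure_pmf.expectation successor_sample
    (\<lambda>sbar. \<Sum>z\<in>Z. c z * (mu_gradient v z - mu_gradient_sample v sbar z)) = 0"
proof -
  have unbiased: "measure_pmf.expectation successor_sample (\<lambda>sbar. mu_gradient_sample v sbar z)
      = mu_gradient v z" if "z \<in> Z" for z
  proof -
    obtain s a where z: "z = (s, a)" "s \<in> S" "a \<in> A" using \<open>z \<in> Z\<close> by blast
    have "measure_pmf.expectation successor_sample (\<lambda>sbar. v (sbar z))
        = measure_pmf.expectation (map_pmf (\<lambda>f. f z) successor_sample) v" by simp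
    also have "map_pmf (\<lambda>f. f z) successor_sample = P s a"
      unfolding successor_sample_def Pi_pmf_component[OF finite_Z] using z by simp
    also have "measure_pmf.expectation (P s a) v = (\<Sum>s'\<in>S. pmf (P s a) s' * v s')"
      by (rule expectation_finite_support[OF finite_states set_trans[OF z(2,3)]])
    finally show ?thesis
      unfolding mu_gradient_sample_def mu_gradient_def z(1)
      by (simp add: integrable_measure_pmf_finite[OF finite_successor_sample])
  qed
  have int: "integrable successor_sample f" for f :: "_ \<Rightarrow> real"
    by (rule integrable_measure_pmf_finite[OF finite_successor_sample])
  have "measure_pmf.expectation successor_sample
      (\<lambda>sbar. \<Sum>z\<in>Z. c z * (mu_gradient v z - mu_gradient_sample v sbar z))
    = (\<Sum>z\<in>Z. c z * (mu_gradient v z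
        - measure_pmf.expectation successor_sample (\<lambda>sbar. mu_gradient_sample v sbar z)))"
    using int by (simp add: Bochner_Integration.integral_diff)
  also have "\<dots> = 0" using unbiased by simp
  finally show ?thesis .
qed

lemma mu_gradient_sample_bounds:
  assumes "sbar \<in> set_pmf successor_sample" "z \<in> Z"
  shows "mu_gradient_sample v sbar z \<in> {- 2 * sup_norm M v..1 + 2 * sup_norm M v}"
proof -
  obtain s a where z: "z = (s, a)" "s \<in> S" "a \<in> A" using assms(2) by blast
  have "\<bar>v (sbar z)\<bar> \<le> sup_norm M v" "\<bar>v s\<bar> \<le> sup_norm M v"
    using successor_sample_in_S[OF assms] z finite_states by (auto intro: abs_le_sup_norm)
  then show ?thesis
    using reward_bounds[OF z(2,3)] unfolding mu_gradient_sample_def z(1) by auto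
qed

text \<open>A difference of two basis vectors: the cross term can only decrease the sum.\<close>

lemma sum_v_gradient_sample_squares: "(\<Sum>x\<in>S. (v_gradient_sample s s' x)\<^sup>2) \<le> 2"
proof -
  have "(v_gradient_sample s s' x)\<^sup>2 \<le> of_bool (x = s') + of_bool (x = s)" for x
    unfolding v_gradient_sample_def by auto
  then have "(\<Sum>x\<in>S. (v_gradient_sample s s' x)\<^sup>2) \<le> (\<Sum>x\<in>S. of_bool (x = s') + of_bool (x = s))"
    by (intro sum_mono)
  also have "\<dots> \<le> 2" using finite_states by (simp add: sum.distrib sum.delta of_bool_def)
  finally show ?thesis .
qed

text \<open>The v-gradient is the adjoint of the map from \<open>w\<close> to its expected change,
  applied to \<open>p\<close>. This brings the v-player's terms into the form of the
  mu-player's.\<close>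

lemma sum_mult_v_gradient:
  "(\<Sum>x\<in>S. w x * v_gradient p x)
    = (\<Sum>(s, a)\<in>Z. pmf p (s, a) * ((\<Sum>s'\<in>S. pmf (P s a) s' * w s') - w s))"
proof -
  have "(\<Sum>x\<in>S. w x * v_gradient p x)
      = (\<Sum>z\<in>Z. \<Sum>x\<in>S. w x * (pmf p z * (pmf (P (fst z) (snd z)) x - of_bool (x = fst z))))"
    unfolding v_gradient_def sum_distrib_left by (subst sum.swap) (simp add: case_prod_beta)
  also have "\<dots> = (\<Sum>z\<in>Z. pmf p z * ((\<Sum>s'\<in>S. pmf (P (fst z) (snd z)) s' * w s') - w (fst z)))"
  proof (intro sum.cong refl)
    fix z assume "z \<in> Z"
    then have "(\<Sum>x\<in>S. of_bool (x = fst z) * w x) = w (fst z)" using finite_states by auto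
    moreover have "(\<Sum>x\<in>S. w x * (pmf p z * (pmf (P (fst z) (snd z)) x - of_bool (x = fst z))))
        = pmf p z * ((\<Sum>s'\<in>S. pmf (P (fst z) (snd z)) s' * w s') - (\<Sum>x\<in>S. of_bool (x = fst z) * w x))"
      unfolding sum_subtractf[symmetric] sum_distrib_left
      by (intro sum.cong refl) (simp add: algebra_simps)
    ultimately show "(\<Sum>x\<in>S. w x * (pmf p z * (pmf (P (fst z) (snd z)) x - of_bool (x = fst z))))
        = pmf p z * ((\<Sum>s'\<in>S. pmf (P (fst z) (snd z)) s' * w s') - w (fst z))" by simp
  qed
  finally show ?thesis by (simp add: case_prod_beta)
qed

end

section \<open>The algorithm as a recursion, and its expected duality gap\<close>

locale comida = ergodic_mdp M for M :: "('s, 'a) mdp" +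
  fixes \<eta>\<^sub>v \<eta>\<^sub>\<mu> :: real
  assumes \<eta>\<^sub>v_pos: "0 < \<eta>\<^sub>v" and \<eta>\<^sub>\<mu>_pos: "0 < \<eta>\<^sub>\<mu>"
begin

text \<open>A deterministic update: the randomness of a round sits entirely in the independent pair
  \<open>samples p\<close>, whose components are averaged separately.\<close>

definition step :: "('s \<Rightarrow> real) \<Rightarrow> ('s \<times> 'a) pmf \<Rightarrow> ('s \<times> 's) \<times> ('s \<times> 'a \<Rightarrow> 's)
    \<Rightarrow> ('s \<Rightarrow> real) \<times> ('s \<times> 'a) pmf" where
  "step v p = (\<lambda>((s, s'), sbar). (v_update M \<eta>\<^sub>v (4 * \<eta>\<^sub>\<mu>) v (v_gradient_sample s s'),
     \<mu>_update M \<eta>\<^sub>\<mu> p (mu_gradient_sample v sbar)))"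

abbreviation "samples p \<equiv> pair_pmf (transition_sample p) successor_sample"

abbreviation "iterates \<equiv> comida_iterates M \<eta>\<^sub>v \<eta>\<^sub>\<mu> (4 * \<eta>\<^sub>\<mu>)"

lemma comida_round_eq:
  "comida_round M \<eta>\<^sub>v \<eta>\<^sub>\<mu> (4 * \<eta>\<^sub>\<mu>) (v, p) = map_pmf (step v p) (samples p)"
  unfolding comida_round_def pair_pmf_def transition_sample_def successor_sample_def
    map_pmf_def step_def v_gradient_sample_def[abs_def] mu_gradient_sample_def
  by (simp add: bind_assoc_pmf bind_return_pmf case_prod_unfold)

lemma iterates_Suc:
  "iterates (Suc n) (v, p) = bind_pmf (samples p) (\<lambda>\<omega>. map_pmf ((#) (v, p)) (iterates n (step v p \<omega>)))"
  by (simp add: comida_round_eq bind_map_pmf)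

lemma finite_samples: "p \<in> sa_simplex M \<Longrightarrow> finite (set_pmf (samples p))"
  using finite_subset[OF set_transition_sample] finite_states finite_successor_sample by simp

lemma snd_step: "p \<in> sa_simplex M \<Longrightarrow> snd (step v p \<omega>) \<in> sa_simplex M"
  unfolding step_def using pmf_mu_update(2)[OF finite_states finite_actions _ \<eta>\<^sub>\<mu>_pos]
  by (auto split: prod.splits)

lemma iterates_support:
  assumes "p \<in> sa_simplex M"
  shows "finite (set_pmf (iterates n (v, p)))"
    and "set_pmf (iterates n (v, p)) \<subseteq> {xs. length xs = n \<and> (\<forall>y\<in>set xs. snd y \<in> sa_simplex M)}"
proof -
  have "finite (set_pmf (iterates n (v, p))) \<and>
    set_pmf (iterates n (v, p)) \<subseteq> {xs. length xs = n \<and> (\<forall>y\<in>set xs. snd y \<in> sa_simplex M)}"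
    using assms
  proof (induction n arbitrary: v p)
    case (Suc n)
    have "finite (set_pmf (iterates n (step v p \<omega>))) \<and> set_pmf (iterates n (step v p \<omega>))
        \<subseteq> {xs. length xs = n \<and> (\<forall>y\<in>set xs. snd y \<in> sa_simplex M)}" for \<omega>
      using Suc.IH[OF snd_step[OF Suc.prems], of "fst (step v p \<omega>)" v \<omega>] by simp
    then show ?case
      unfolding iterates_Suc using finite_samples[OF Suc.prems] Suc.prems
      by (fastforce simp del: set_pair_pmf)
  qed simp
  then show "finite (set_pmf (iterates n (v, p)))"
    "set_pmf (iterates n (v, p)) \<subseteq> {xs. length xs = n \<and> (\<forall>y\<in>set xs. snd y \<in> sa_simplex M)}"
    by auto
qed

text \<open>For the bilinear Lagrangian that pairs \<open>\<mu>\<close> with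
  \<open>mu_gradient v\<close>, this is the value at \<open>(x, v)\<close> minus the value at
  \<open>(p, u)\<close>, written as the sum of both players' linearized regrets with exact
  gradients.\<close>

definition gap :: "('s \<times> 'a \<Rightarrow> real) \<Rightarrow> ('s \<Rightarrow> real) \<Rightarrow> ('s \<Rightarrow> real) \<times> ('s \<times> 'a) pmf \<Rightarrow> real" where
  "gap x u = (\<lambda>(v, p). (\<Sum>z\<in>Z. (x z - pmf p z) * mu_gradient v z)
     + (\<Sum>s\<in>S. (v s - u s) * v_gradient p s))"

text \<open>The vector \<open>D\<close> is the gradient noise accumulated so far. Pairing it with \<open>u\<close> here is what
  permits a comparator \<open>u\<close> that depends on the whole run: by the Fenchel-Young inequality the
  pairing costs only \<open>\<parallel>D\<parallel>\<^sup>2\<close>, whose mean grows linearly because \<open>D\<close> is a martingale.\<close>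

definition potential_gap :: "('s \<times> 'a \<Rightarrow> real) \<Rightarrow> ('s \<Rightarrow> real) \<Rightarrow> ('s \<Rightarrow> real) \<Rightarrow> ('s \<Rightarrow> real)
    \<Rightarrow> (('s \<Rightarrow> real) \<times> ('s \<times> 'a) pmf) list \<Rightarrow> real" where
  "potential_gap x u v D xs = (\<Sum>y\<leftarrow>xs. gap x u y) - (\<Sum>s\<in>S. u s * D s)
     - (\<Sum>s\<in>S. (u s - v s)\<^sup>2) / (2 * \<eta>\<^sub>v) - (\<Sum>s\<in>S. (u s)\<^sup>2) / (2 * \<eta>\<^sub>v)
     - real (length xs) * (4 * \<eta>\<^sub>\<mu>) * (sup_norm M u)\<^sup>2"

definition noise :: "('s \<times> 'a) pmf \<Rightarrow> ('s \<times> 's) \<times> ('s \<times> 'a \<Rightarrow> 's) \<Rightarrow> 's \<Rightarrow> real" where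
  "noise p \<omega> s = v_gradient p s - v_gradient_sample (fst (fst \<omega>)) (snd (fst \<omega>)) s"

text \<open>The place where the comparator disappears: completing the square in \<open>u\<close>
  leaves a bound by the noise alone, valid for every \<open>u\<close>.\<close>

lemma potential_gap_Nil: "potential_gap x u v D [] \<le> \<eta>\<^sub>v / 2 * (\<Sum>s\<in>S. (D s)\<^sup>2)"
proof -
  have "- (u s * D s) - (u s)\<^sup>2 / (2 * \<eta>\<^sub>v) \<le> \<eta>\<^sub>v / 2 * (D s)\<^sup>2" for s
  proof -
    have "0 \<le> (u s + \<eta>\<^sub>v * D s)\<^sup>2 / (2 * \<eta>\<^sub>v)" using \<eta>\<^sub>v_pos by simp
    also have "\<dots> = \<eta>\<^sub>v / 2 * (D s)\<^sup>2 + u s * D s + (u s)\<^sup>2 / (2 * \<eta>\<^sub>v)"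
      using \<eta>\<^sub>v_pos by (simp add: field_simps power2_eq_square)
    finally show ?thesis by simp
  qed
  then have "(\<Sum>s\<in>S. - (u s * D s) - (u s)\<^sup>2 / (2 * \<eta>\<^sub>v)) \<le> \<eta>\<^sub>v / 2 * (\<Sum>s\<in>S. (D s)\<^sup>2)"
    unfolding sum_distrib_left by (rule sum_mono)
  moreover have "0 \<le> (\<Sum>s\<in>S. (u s - v s)\<^sup>2) / (2 * \<eta>\<^sub>v)"
    using \<eta>\<^sub>v_pos by (simp add: sum_nonneg)
  ultimately show ?thesis
    unfolding potential_gap_def by (simp add: sum_subtractf sum_negf sum_divide_distrib)
qed

text \<open>A pathwise inequality for one round. The pairing of the noise with \<open>u\<close> is
  not estimated but added to \<open>D\<close>; the pairing with \<open>v\<close> stays, since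
  \<open>v\<close> is known before the round and its term has mean zero. The negative term is the
  regularization at the new iterate, which pays for the next mu-step.\<close>

lemma potential_gap_Cons:
  "potential_gap x u v D ((v, p) # xs)
    \<le> (\<Sum>z\<in>Z. (x z - pmf p z) * mu_gradient v z) + (\<Sum>s\<in>S. v s * noise p \<omega> s) + \<eta>\<^sub>v
      - 4 * \<eta>\<^sub>\<mu> * (sup_norm M (fst (step v p \<omega>)))\<^sup>2
      + potential_gap x u (fst (step v p \<omega>)) (\<lambda>s. D s + noise p \<omega> s) xs"
proof -
  obtain s s' sbar where \<omega>: "\<omega> = ((s, s'), sbar)" by (metis surj_pair)
  let ?g = "v_gradient_sample s s'"
  define v' where "v' = fst (step v p \<omega>)"
  have v': "v' = v_update M \<eta>\<^sub>v (4 * \<eta>\<^sub>\<mu>) v ?g" by (simp add: v'_def step_def \<omega>)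
  have noise: "noise p \<omega> x = v_gradient p x - ?g x" for x by (simp add: noise_def \<omega>)
  have regret: "(\<Sum>s\<in>S. (v s - u s) * ?g s)
      \<le> (\<Sum>s\<in>S. (u s - v s)\<^sup>2) / (2 * \<eta>\<^sub>v) - (\<Sum>s\<in>S. (u s - v' s)\<^sup>2) / (2 * \<eta>\<^sub>v)
        + \<eta>\<^sub>v / 2 * (\<Sum>s\<in>S. (?g s)\<^sup>2) + 4 * \<eta>\<^sub>\<mu> * (sup_norm M u)\<^sup>2 - 4 * \<eta>\<^sub>\<mu> * (sup_norm M v')\<^sup>2"
    unfolding v' using \<eta>\<^sub>v_pos \<eta>\<^sub>\<mu>_pos finite_states states_ne by (intro v_update_regret) auto
  have "\<eta>\<^sub>v / 2 * (\<Sum>s\<in>S. (?g s)\<^sup>2) \<le> \<eta>\<^sub>v / 2 * 2"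
    using \<eta>\<^sub>v_pos sum_v_gradient_sample_squares by (intro mult_left_mono) auto
  moreover have "(\<Sum>s\<in>S. (v s - u s) * v_gradient p s) - (\<Sum>s\<in>S. u s * D s)
      = (\<Sum>s\<in>S. (v s - u s) * ?g s) + (\<Sum>s\<in>S. v s * noise p \<omega> s)
        - (\<Sum>s\<in>S. u s * (D s + noise p \<omega> s))"
    unfolding noise sum_subtractf[symmetric] sum.distrib[symmetric]
    by (intro sum.cong) (auto simp: algebra_simps)
  ultimately show ?thesis
    using regret unfolding v'_def[symmetric] potential_gap_def gap_def
    by (simp add: algebra_simps)
qed

text \<open>Pathwise form of the variance bound. With \<open>N = g - h\<close> for the mean
  \<open>g\<close> and the sample \<open>h\<close>, the square of \<open>D + N\<close> is
  \<open>D\<^sup>2 + h\<^sup>2 - g\<^sup>2 + 2 * (D + g) * N\<close>. The negative square is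
  dropped, and the last term is linear in the noise with coefficients known before the
  round.\<close>

lemma noise_square_le:
  "\<eta>\<^sub>v / 2 * (\<Sum>s\<in>S. (D s + noise p \<omega> s)\<^sup>2)
    \<le> \<eta>\<^sub>v / 2 * (\<Sum>s\<in>S. (D s)\<^sup>2) + \<eta>\<^sub>v + (\<Sum>s\<in>S. \<eta>\<^sub>v * (D s + v_gradient p s) * noise p \<omega> s)"
proof -
  let ?g = "v_gradient_sample (fst (fst \<omega>)) (snd (fst \<omega>))"
  have "(\<Sum>s\<in>S. (D s + noise p \<omega> s)\<^sup>2)
      \<le> (\<Sum>s\<in>S. (D s)\<^sup>2 + (?g s)\<^sup>2 + 2 * ((D s + v_gradient p s) * noise p \<omega> s))"
  proof (rule sum_mono)
    fix s
    have "(D s)\<^sup>2 + (?g s)\<^sup>2 + 2 * ((D s + v_gradient p s) * noise p \<omega> s)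
        = (D s + noise p \<omega> s)\<^sup>2 + (v_gradient p s)\<^sup>2"
      unfolding noise_def by (simp add: algebra_simps power2_eq_square)
    then show "(D s + noise p \<omega> s)\<^sup>2
        \<le> (D s)\<^sup>2 + (?g s)\<^sup>2 + 2 * ((D s + v_gradient p s) * noise p \<omega> s)" by simp
  qed
  also have "\<dots> \<le> (\<Sum>s\<in>S. (D s)\<^sup>2) + 2 + 2 * (\<Sum>s\<in>S. (D s + v_gradient p s) * noise p \<omega> s)"
    using sum_v_gradient_sample_squares[of "fst (fst \<omega>)" "snd (fst \<omega>)"]
    by (simp add: sum.distrib sum_distrib_left)
  finally have "\<eta>\<^sub>v / 2 * (\<Sum>s\<in>S. (D s + noise p \<omega> s)\<^sup>2)
      \<le> \<eta>\<^sub>v / 2 * ((\<Sum>s\<in>S. (D s)\<^sup>2) + 2 + 2 * (\<Sum>s\<in>S. (D s + v_gradient p s) * noise p \<omega> s))"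
    using \<eta>\<^sub>v_pos by (intro mult_left_mono) auto
  then show ?thesis by (simp add: algebra_simps sum_distrib_left)
qed

lemma mu_step_regret:
  assumes p: "p \<in> sa_simplex M"
    and x: "\<And>z. z \<in> Z \<Longrightarrow> 0 \<le> x z" "\<And>z. z \<in> Z \<Longrightarrow> pmf p z = 0 \<Longrightarrow> x z = 0" "sum x Z = 1"
    and \<omega>: "\<omega> \<in> set_pmf (samples p)"
  shows "(\<Sum>z\<in>Z. x z * ln (x z / pmf (snd (step v p \<omega>)) z)) / \<eta>\<^sub>\<mu>
    \<le> (\<Sum>z\<in>Z. x z * ln (x z / pmf p z)) / \<eta>\<^sub>\<mu>
      - (\<Sum>z\<in>Z. (x z - pmf p z) * mu_gradient_sample v (snd \<omega>) z)
      + \<eta>\<^sub>\<mu> + 4 * \<eta>\<^sub>\<mu> * (sup_norm M v)\<^sup>2"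
proof -
  let ?V = "sup_norm M v" and ?g = "mu_gradient_sample v (snd \<omega>)"
  have step: "snd (step v p \<omega>) = \<mu>_update M \<eta>\<^sub>\<mu> p ?g"
    by (simp add: step_def case_prod_beta)
  have sbar: "snd \<omega> \<in> set_pmf successor_sample" using \<omega> by auto
  have "(\<Sum>z\<in>Z. x z * ln (x z / pmf (snd (step v p \<omega>)) z))
      \<le> (\<Sum>z\<in>Z. x z * ln (x z / pmf p z)) - \<eta>\<^sub>\<mu> * (\<Sum>z\<in>Z. (x z - pmf p z) * ?g z)
        + \<eta>\<^sub>\<mu>\<^sup>2 * ((1 + 2 * ?V) - (- 2 * ?V))\<^sup>2 / 8"
    unfolding step
    by (rule mu_update_regret[OF finite_states finite_actions p \<eta>\<^sub>\<mu>_pos])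
      (use x mu_gradient_sample_bounds[OF sbar] in auto)
  then have "(\<Sum>z\<in>Z. x z * ln (x z / pmf (snd (step v p \<omega>)) z)) / \<eta>\<^sub>\<mu>
      \<le> ((\<Sum>z\<in>Z. x z * ln (x z / pmf p z)) - \<eta>\<^sub>\<mu> * (\<Sum>z\<in>Z. (x z - pmf p z) * ?g z)
        + \<eta>\<^sub>\<mu>\<^sup>2 * ((1 + 2 * ?V) - (- 2 * ?V))\<^sup>2 / 8) / \<eta>\<^sub>\<mu>"
    using \<eta>\<^sub>\<mu>_pos by (intro divide_right_mono) auto
  also have "\<dots> = (\<Sum>z\<in>Z. x z * ln (x z / pmf p z)) / \<eta>\<^sub>\<mu> - (\<Sum>z\<in>Z. (x z - pmf p z) * ?g z)
      + \<eta>\<^sub>\<mu> * ((4 * ?V + 1)\<^sup>2 / 8)"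
    using \<eta>\<^sub>\<mu>_pos by (simp add: add_divide_distrib diff_divide_distrib power2_eq_square)
  \<comment> \<open>The coefficient 4 of the squared norm is the one chosen in the regularization
    \<open>4 * \<eta>\<^sub>\<mu>\<close>.\<close>
  also have "(4 * ?V + 1)\<^sup>2 / 8 \<le> 1 + 4 * ?V\<^sup>2"
  proof -
    have "0 \<le> (4 * ?V - 1)\<^sup>2" by simp
    then show ?thesis by (simp add: power2_eq_square algebra_simps)
  qed
  finally show ?thesis using \<eta>\<^sub>\<mu>_pos by (simp add: algebra_simps)
qed

text \<open>Exponential weights never extinguish mass, so the comparator's relative entropy to the
  iterates stays meaningful in every round.\<close>

lemma pmf_step_eq_0:
  assumes "p \<in> sa_simplex M" "pmf (snd (step v p \<omega>)) z = 0"
  shows "pmf p z = 0"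
proof -
  have "0 < (\<Sum>y\<in>Z. pmf p y * exp (\<eta>\<^sub>\<mu> * mu_gradient_sample v (snd \<omega>) y))"
    by (rule mgf_pos[OF finite_Z set_simplex[OF assms(1)]])
  then show ?thesis
    using assms(2) pmf_mu_update(1)[OF finite_states finite_actions assms(1) \<eta>\<^sub>\<mu>_pos]
    by (simp add: step_def case_prod_beta)
qed

text \<open>Induction on the number of remaining rounds, with the right-hand side as potential. The
  comparator is a function \<open>u\<close> of the remaining run, generalized in the induction;
  after the first round it becomes \<open>u\<close> applied to the list with that round's iterate
  prepended.\<close>

lemma expected_potential_gap:
  assumes "p \<in> sa_simplex M"
    and x: "\<And>z. z \<in> Z \<Longrightarrow> 0 \<le> x z" "sum x Z = 1"
    and "\<And>z. z \<in> Z \<Longrightarrow> pmf p z = 0 \<Longrightarrow> x z = 0"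
  shows "measure_pmf.expectation (iterates n (v, p)) (\<lambda>xs. potential_gap x (u xs) v D xs)
    \<le> (\<Sum>z\<in>Z. x z * ln (x z / pmf p z)) / \<eta>\<^sub>\<mu> + 4 * \<eta>\<^sub>\<mu> * (sup_norm M v)\<^sup>2
      + real n * (\<eta>\<^sub>\<mu> + 2 * \<eta>\<^sub>v) + \<eta>\<^sub>v / 2 * (\<Sum>s\<in>S. (D s)\<^sup>2)"
  using assms(1,4)
proof (induction n arbitrary: v p D u)
  case 0
  have "0 \<le> (\<Sum>z\<in>Z. x z * ln (x z / pmf p z))"
  proof (rule relative_entropy_nonneg(1)[OF finite_Z])
    show "sum x Z = sum (pmf p) Z"
      using x(2) sum_pmf_eq_1[OF finite_Z set_simplex[OF 0(1)]] by simp
  qed (use x 0 in auto)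
  then have "0 \<le> (\<Sum>z\<in>Z. x z * ln (x z / pmf p z)) / \<eta>\<^sub>\<mu> + 4 * \<eta>\<^sub>\<mu> * (sup_norm M v)\<^sup>2"
    using \<eta>\<^sub>\<mu>_pos by simp
  then show ?case using potential_gap_Nil[of x "u []" v D] by simp
next
  case (Suc n)
  note p = Suc.prems(1)
  define K where "K = (\<Sum>z\<in>Z. x z * ln (x z / pmf p z)) / \<eta>\<^sub>\<mu> + 4 * \<eta>\<^sub>\<mu> * (sup_norm M v)\<^sup>2
      + real (Suc n) * (\<eta>\<^sub>\<mu> + 2 * \<eta>\<^sub>v) + \<eta>\<^sub>v / 2 * (\<Sum>s\<in>S. (D s)\<^sup>2)"
  \<comment> \<open>All contributions linear in the v-noise, from the iterate \<open>v\<close> and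
    from the growth of \<open>D\<close>; their coefficients are known before sampling.\<close>
  define L\<^sub>v where "L\<^sub>v = (\<lambda>(s, s'). \<Sum>x\<in>S. (v x + \<eta>\<^sub>v * (D x + v_gradient p x))
      * (v_gradient p x - v_gradient_sample s s' x))"
  define L\<^sub>\<mu> where "L\<^sub>\<mu> = (\<lambda>sbar. \<Sum>z\<in>Z. (x z - pmf p z) * (mu_gradient v z - mu_gradient_sample v sbar z))"
  have fin: "finite (set_pmf (iterates n (step v p \<omega>)))" for \<omega>
    using iterates_support(1)[OF snd_step[OF p], of n "fst (step v p \<omega>)" v \<omega>] by simp
  have "measure_pmf.expectation (map_pmf ((#) (v, p)) (iterates n (step v p \<omega>)))
      (\<lambda>xs. potential_gap x (u xs) v D xs) \<le> K + L\<^sub>v (fst \<omega>) + L\<^sub>\<mu> (snd \<omega>)"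
    if \<omega>: "\<omega> \<in> set_pmf (samples p)" for \<omega>
  proof -
    let ?v = "fst (step v p \<omega>)" and ?p = "snd (step v p \<omega>)" and ?D = "\<lambda>s. D s + noise p \<omega> s"
    define c where "c = (\<Sum>z\<in>Z. (x z - pmf p z) * mu_gradient v z) + (\<Sum>s\<in>S. v s * noise p \<omega> s) + \<eta>\<^sub>v
      - 4 * \<eta>\<^sub>\<mu> * (sup_norm M ?v)\<^sup>2"
    have p': "?p \<in> sa_simplex M" by (rule snd_step[OF p])
    have int: "integrable (iterates n (?v, ?p)) f" for f :: "_ \<Rightarrow> real"
      by (rule integrable_measure_pmf_finite[OF iterates_support(1)[OF p']])
    have "measure_pmf.expectation (iterates n (?v, ?p))
        (\<lambda>xs. potential_gap x (u ((v, p) # xs)) v D ((v, p) # xs))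
      \<le> measure_pmf.expectation (iterates n (?v, ?p))
        (\<lambda>xs. c + potential_gap x (u ((v, p) # xs)) ?v ?D xs)"
      by (intro integral_mono int) (simp only: c_def potential_gap_Cons)
    also have "\<dots> = c + measure_pmf.expectation (iterates n (?v, ?p))
        (\<lambda>xs. potential_gap x (u ((v, p) # xs)) ?v ?D xs)"
      using int by simp
    also have "\<dots> \<le> c + ((\<Sum>z\<in>Z. x z * ln (x z / pmf ?p z)) / \<eta>\<^sub>\<mu> + 4 * \<eta>\<^sub>\<mu> * (sup_norm M ?v)\<^sup>2
        + real n * (\<eta>\<^sub>\<mu> + 2 * \<eta>\<^sub>v) + \<eta>\<^sub>v / 2 * (\<Sum>s\<in>S. (?D s)\<^sup>2))"
      using pmf_step_eq_0[OF p] Suc.prems(2) by (intro add_left_mono Suc.IH p') blast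
    also have "\<dots> \<le> K + L\<^sub>v (fst \<omega>) + L\<^sub>\<mu> (snd \<omega>)"
    proof -
      have "L\<^sub>v (fst \<omega>) = (\<Sum>s\<in>S. v s * noise p \<omega> s)
          + (\<Sum>s\<in>S. \<eta>\<^sub>v * (D s + v_gradient p s) * noise p \<omega> s)"
        unfolding L\<^sub>v_def noise_def sum.distrib[symmetric] case_prod_beta
        by (intro sum.cong refl) (simp add: algebra_simps)
      moreover have "L\<^sub>\<mu> (snd \<omega>) = (\<Sum>z\<in>Z. (x z - pmf p z) * mu_gradient v z)
          - (\<Sum>z\<in>Z. (x z - pmf p z) * mu_gradient_sample v (snd \<omega>) z)"
        unfolding L\<^sub>\<mu>_def sum_subtractf[symmetric] by (intro sum.cong refl) (simp add: algebra_simps)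
      moreover have "real (Suc n) * (\<eta>\<^sub>\<mu> + 2 * \<eta>\<^sub>v) = real n * (\<eta>\<^sub>\<mu> + 2 * \<eta>\<^sub>v) + \<eta>\<^sub>\<mu> + 2 * \<eta>\<^sub>v"
        by (simp add: algebra_simps)
      ultimately show ?thesis
        using mu_step_regret[OF p x(1) Suc.prems(2) x(2) \<omega>, of v] noise_square_le[of D p \<omega>]
        unfolding c_def K_def by linarith
    qed
    finally show ?thesis by simp
  qed
  then have "measure_pmf.expectation (iterates (Suc n) (v, p)) (\<lambda>xs. potential_gap x (u xs) v D xs)
      \<le> measure_pmf.expectation (samples p) (\<lambda>\<omega>. K + L\<^sub>v (fst \<omega>) + L\<^sub>\<mu> (snd \<omega>))"
    unfolding iterates_Suc by (intro expectation_bind_le finite_samples p) (simp_all add: fin)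
  also have "\<dots> = K + measure_pmf.expectation (samples p) (\<lambda>\<omega>. L\<^sub>v (fst \<omega>))
      + measure_pmf.expectation (samples p) (\<lambda>\<omega>. L\<^sub>\<mu> (snd \<omega>))"
    by (simp add: integrable_measure_pmf_finite[OF finite_samples[OF p]])
  also have "measure_pmf.expectation (samples p) (\<lambda>\<omega>. L\<^sub>v (fst \<omega>))
      = measure_pmf.expectation (transition_sample p) L\<^sub>v"
    using integral_map_pmf[of fst "samples p" L\<^sub>v] by (simp add: map_fst_pair_pmf)
  also have "measure_pmf.expectation (samples p) (\<lambda>\<omega>. L\<^sub>\<mu> (snd \<omega>))
      = measure_pmf.expectation successor_sample L\<^sub>\<mu>"
    using integral_map_pmf[of snd "samples p" L\<^sub>\<mu>] by (simp add: map_snd_pair_pmf)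
  also have "measure_pmf.expectation (transition_sample p) L\<^sub>v = 0"
    unfolding L\<^sub>v_def by (rule v_gradient_mean_zero[OF p])
  also have "measure_pmf.expectation successor_sample L\<^sub>\<mu> = 0"
    unfolding L\<^sub>\<mu>_def by (rule mu_gradient_mean_zero)
  finally show ?case by (simp add: K_def)
qed

end

section \<open>Suboptimality of the output policy\<close>

lemma sum_sum_list: "(\<Sum>z\<in>A. \<Sum>y\<leftarrow>xs. f y z) = (\<Sum>y\<leftarrow>xs. \<Sum>z\<in>A. (f y z :: real))"
  by (induction xs) (simp_all add: sum.distrib)

context ergodic_mdp
begin

lemma average_iterate_nonneg: "0 \<le> average_iterate xs z"
  unfolding average_iterate_def by (auto intro!: divide_nonneg_nonneg sum_list_nonneg)

context
  fixes xs :: "(('s \<Rightarrow> real) \<times> ('s \<times> 'a) pmf) list" and \<pi>\<^sub>0 :: "'s \<Rightarrow> 'a pmf"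
  assumes xs_ne: "xs \<noteq> []" and xs_simplex: "\<And>y. y \<in> set xs \<Longrightarrow> snd y \<in> sa_simplex M"
    and \<pi>\<^sub>0: "\<pi>\<^sub>0 \<in> policies M"
begin

lemma average_iterate_eq_0: "z \<notin> Z \<Longrightarrow> average_iterate xs z = 0"
proof -
  assume "z \<notin> Z"
  then have "pmf (snd y) z = 0" if "y \<in> set xs" for y
    using set_simplex[OF xs_simplex[OF that]] by (meson pmf_eq_0_set_pmf subsetD)
  then have "(\<Sum>(v, \<mu>)\<leftarrow>xs. pmf \<mu> z) = (\<Sum>y\<leftarrow>xs. 0)"
    by (intro arg_cong[where f = sum_list] map_cong) (auto simp: case_prod_beta)
  then show ?thesis by (simp add: average_iterate_def)
qed

lemma length_mult_sum_average_iterate: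
  "real (length xs) * (\<Sum>z\<in>Z. average_iterate xs z * f z) = (\<Sum>y\<leftarrow>xs. \<Sum>z\<in>Z. pmf (snd y) z * f z)"
proof -
  have "real (length xs) * (\<Sum>z\<in>Z. average_iterate xs z * f z)
      = (\<Sum>z\<in>Z. (\<Sum>y\<leftarrow>xs. pmf (snd y) z) * f z)"
    using xs_ne by (simp add: average_iterate_def sum_distrib_left case_prod_unfold)
  then show ?thesis
    by (simp add: sum_list_mult_const[symmetric] sum_sum_list)
qed

lemma sum_average_iterate: "(\<Sum>z\<in>Z. average_iterate xs z) = 1"
proof -
  have "(\<Sum>z\<in>Z. pmf (snd y) z) = 1" if "y \<in> set xs" for y
    by (rule sum_pmf_eq_1[OF finite_Z set_simplex[OF xs_simplex[OF that]]])
  then have "(\<Sum>y\<leftarrow>xs. \<Sum>z\<in>Z. pmf (snd y) z) = (\<Sum>y\<leftarrow>xs. 1)"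
    by (intro arg_cong[where f = sum_list] map_cong) auto
  then have "real (length xs) * (\<Sum>z\<in>Z. average_iterate xs z) = real (length xs)"
    using length_mult_sum_average_iterate[of "\<lambda>_. 1"] by (simp add: sum_list_triv)
  then show ?thesis using xs_ne by simp
qed

lemma pmf_output_policy:
  assumes "(\<Sum>a\<in>A. average_iterate xs (s, a)) \<noteq> 0"
  shows "pmf (output_policy M \<pi>\<^sub>0 xs s) a = average_iterate xs (s, a) / (\<Sum>a\<in>A. average_iterate xs (s, a))"
proof -
  have "0 \<le> (\<Sum>a\<in>A. average_iterate xs (s, a))"
    by (simp add: sum_nonneg average_iterate_nonneg)
  moreover have "average_iterate xs (s, b) = 0" if "b \<notin> A" for b
    using that by (intro average_iterate_eq_0) auto
  ultimately show ?thesis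
    unfolding output_policy_def Let_def using assms
    by (simp, intro pmf_embed_finite[OF finite_actions])
      (auto simp: average_iterate_nonneg simp flip: sum_divide_distrib)
qed

lemma output_policy_in_policies: "output_policy M \<pi>\<^sub>0 xs \<in> policies M"
  unfolding policies_def
proof (intro CollectI ballI)
  fix s assume s: "s \<in> S"
  show "set_pmf (output_policy M \<pi>\<^sub>0 xs s) \<subseteq> A"
  proof (cases "(\<Sum>a\<in>A. average_iterate xs (s, a)) = 0")
    case True
    then show ?thesis using set_policy[OF \<pi>\<^sub>0 s] by (simp add: output_policy_def)
  next
    case False
    have "average_iterate xs (s, a) = 0" if "a \<notin> A" for a
      using that by (intro average_iterate_eq_0) auto
    then show ?thesis using pmf_output_policy[OF False] by (auto simp: set_pmf_eq)
  qed
qed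

text \<open>In a state without mass all the entries are 0, so the equation holds there for whatever
  the fallback policy does.\<close>

lemma average_iterate_disintegration:
  assumes "a \<in> A"
  shows "average_iterate xs (s, a) = (\<Sum>a\<in>A. average_iterate xs (s, a)) * pmf (output_policy M \<pi>\<^sub>0 xs s) a"
proof (cases "(\<Sum>a\<in>A. average_iterate xs (s, a)) = 0")
  case True
  then show ?thesis
    using assms finite_actions by (simp add: sum_nonneg_eq_0_iff average_iterate_nonneg)
qed (simp add: pmf_output_policy)

text \<open>The Bellman equation makes the action average the same constant in every state, so any
  weighting of the states gives that constant. Hence the average iterate can be used although it
  need not be the occupancy of the output policy.\<close>

lemma average_bellman:
  assumes "s\<^sub>0 \<in> S"
  defines "\<pi> \<equiv> output_policy M \<pi>\<^sub>0 xs"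
  shows "(\<Sum>z\<in>Z. average_iterate xs z * mu_gradient (bias M \<pi>) z) = avg_reward M \<pi> s\<^sub>0"
proof -
  note \<pi> = output_policy_in_policies[folded \<pi>_def]
  let ?d = "\<lambda>s. \<Sum>a\<in>A. average_iterate xs (s, a)"
  have bellman: "(\<Sum>a\<in>A. pmf (\<pi> s) a * mu_gradient (bias M \<pi>) (s, a)) = avg_reward M \<pi> s\<^sub>0" if s: "s \<in> S" for s
  proof -
    have "avg_reward M \<pi> s = avg_reward M \<pi> s\<^sub>0"
      using avg_reward_eq[OF \<pi>] s assms(1) by simp
    then have "bias M \<pi> s = (\<Sum>a\<in>A. pmf (\<pi> s) a *
        (reward M s a - avg_reward M \<pi> s\<^sub>0 + (\<Sum>s'\<in>S. pmf (P s a) s' * bias M \<pi> s')))"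
      using bellman_equation[OF \<pi> s] by (simp only:)
    also have "\<dots> = (\<Sum>a\<in>A. pmf (\<pi> s) a * (mu_gradient (bias M \<pi>) (s, a)
        + (bias M \<pi> s - avg_reward M \<pi> s\<^sub>0)))"
      unfolding mu_gradient_def by (intro sum.cong refl) (simp add: algebra_simps)
    also have "\<dots> = (\<Sum>a\<in>A. pmf (\<pi> s) a * mu_gradient (bias M \<pi>) (s, a))
        + (bias M \<pi> s - avg_reward M \<pi> s\<^sub>0)"
      using sum_policy[OF \<pi> s] by (simp add: distrib_left sum.distrib flip: sum_distrib_right)
    finally show ?thesis by simp
  qed
  have "(\<Sum>z\<in>Z. average_iterate xs z * mu_gradient (bias M \<pi>) z)
      = (\<Sum>s\<in>S. \<Sum>a\<in>A. average_iterate xs (s, a) * mu_gradient (bias M \<pi>) (s, a))"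
    by (simp add: sum.cartesian_product')
  also have "\<dots> = (\<Sum>s\<in>S. ?d s * (\<Sum>a\<in>A. pmf (\<pi> s) a * mu_gradient (bias M \<pi>) (s, a)))"
    unfolding sum_distrib_left
  proof (intro sum.cong refl)
    fix s a assume "a \<in> A"
    then show "average_iterate xs (s, a) * mu_gradient (bias M \<pi>) (s, a)
        = ?d s * (pmf (\<pi> s) a * mu_gradient (bias M \<pi>) (s, a))"
      by (subst average_iterate_disintegration) (simp_all add: \<pi>_def)
  qed
  also have "\<dots> = (\<Sum>s\<in>S. ?d s) * avg_reward M \<pi> s\<^sub>0"
    by (simp add: bellman sum_distrib_right)
  also have "(\<Sum>s\<in>S. ?d s) = 1"
    using sum_average_iterate by (simp add: sum.cartesian_product')
  finally show ?thesis by simp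
qed

end

end

context comida
begin

text \<open>The iterate \<open>v\<close> cancels: on the side of the occupancy by balance, and on
  the side of \<open>p\<close> because the v-gradient is the adjoint.\<close>

lemma gap_occupancy:
  assumes "\<pi> \<in> policies M"
  shows "gap (occupancy M \<pi>) u (v, p) = sa_inner M (occupancy M \<pi>) (\<lambda>(s, a). reward M s a)
    - (\<Sum>z\<in>Z. pmf p z * mu_gradient u z)"
proof -
  let ?x = "occupancy M \<pi>"
  have split: "(\<Sum>z\<in>Z. y z * mu_gradient w z) = (\<Sum>z\<in>Z. y z * (case z of (s, a) \<Rightarrow> reward M s a))
      + (\<Sum>(s, a)\<in>Z. y (s, a) * ((\<Sum>s'\<in>S. pmf (P s a) s' * w s') - w s))" for y w
    unfolding sum.distrib[symmetric] mu_gradient_def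
    by (intro sum.cong refl) (auto simp: algebra_simps)
  have "(\<Sum>s\<in>S. (v s - u s) * v_gradient p s)
      = (\<Sum>s\<in>S. v s * v_gradient p s) - (\<Sum>s\<in>S. u s * v_gradient p s)"
    by (simp add: left_diff_distrib sum_subtractf)
  moreover have "(\<Sum>z\<in>Z. (?x z - pmf p z) * mu_gradient v z)
      = (\<Sum>z\<in>Z. ?x z * mu_gradient v z) - (\<Sum>z\<in>Z. pmf p z * mu_gradient v z)"
    by (simp add: left_diff_distrib sum_subtractf)
  ultimately show ?thesis
    unfolding gap_def sum_mult_v_gradient sa_inner_def
    using split[of ?x v] split[of "pmf p" v] split[of "pmf p" u] occupancy_balance[OF assms, of v]
    by simp
qed

text \<open>Each gap is affine in the iterate's distribution, so only the average iterate matters.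
  The comparator is the bias of the very policy that this run outputs, which is why it cannot be
  fixed in advance.\<close>

lemma sum_gap:
  assumes xs: "xs \<noteq> []" "\<And>y. y \<in> set xs \<Longrightarrow> snd y \<in> sa_simplex M"
    and \<pi>\<^sub>0: "\<pi>\<^sub>0 \<in> policies M" and \<pi>': "\<pi>' \<in> policies M"
  defines "\<pi> \<equiv> output_policy M \<pi>\<^sub>0 xs"
  shows "(\<Sum>y\<leftarrow>xs. gap (occupancy M \<pi>') (bias M \<pi>) y) = real (length xs) * suboptimality M \<pi>' \<pi>"
proof -
  obtain s where s: "s \<in> S" using states_ne by blast
  have \<pi>: "\<pi> \<in> policies M" unfolding \<pi>_def by (rule output_policy_in_policies[OF xs \<pi>\<^sub>0])
  have "(\<Sum>y\<leftarrow>xs. gap (occupancy M \<pi>') (bias M \<pi>) y)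
      = (\<Sum>y\<leftarrow>xs. avg_reward M \<pi>' s - (\<Sum>z\<in>Z. pmf (snd y) z * mu_gradient (bias M \<pi>) z))"
    unfolding avg_reward_eq[OF \<pi>' s]
    by (intro arg_cong[where f = sum_list] map_cong refl) (metis gap_occupancy[OF \<pi>'] prod.collapse)
  also have "\<dots> = real (length xs) * avg_reward M \<pi>' s
      - real (length xs) * (\<Sum>z\<in>Z. average_iterate xs z * mu_gradient (bias M \<pi>) z)"
    by (simp add: length_mult_sum_average_iterate[OF xs \<pi>\<^sub>0] sum_list_subtractf sum_list_triv)
  also have "\<dots> = real (length xs) * suboptimality M \<pi>' \<pi>"
    using average_bellman[OF xs \<pi>\<^sub>0 s, folded \<pi>_def] suboptimality_eq[OF \<pi> \<pi>' s]
    by (simp add: right_diff_distrib)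
  finally show ?thesis .
qed

lemma sup_norm_square_le: "(sup_norm M u)\<^sup>2 \<le> (L2_set u S)\<^sup>2"
proof -
  have "sup_norm M u \<in> (\<lambda>s. \<bar>u s\<bar>) ` S"
    unfolding sup_norm_def using finite_states states_ne by (intro Max_in) auto
  then obtain s where "s \<in> S" "sup_norm M u = \<bar>u s\<bar>" by blast
  then show ?thesis
    unfolding L2_set_squared using finite_states member_le_sum[of s S "\<lambda>s. (u s)\<^sup>2"] by simp
qed

lemma comida_mdp_eq:
  "comida_mdp M \<eta>\<^sub>v \<eta>\<^sub>\<mu> (4 * \<eta>\<^sub>\<mu>) \<mu>\<^sub>1 \<pi>\<^sub>0 T = map_pmf (output_policy M \<pi>\<^sub>0) (iterates T (\<lambda>_. 0, \<mu>\<^sub>1))"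
  unfolding comida_mdp_def ..

lemma iterates_output_in_policies:
  assumes "1 \<le> T" "\<mu>\<^sub>1 \<in> sa_simplex M" "\<pi>\<^sub>0 \<in> policies M" "xs \<in> set_pmf (iterates T (v, \<mu>\<^sub>1))"
  shows "output_policy M \<pi>\<^sub>0 xs \<in> policies M"
  using iterates_support(2)[OF assms(2), of T v] assms by (intro output_policy_in_policies) auto

lemma expected_suboptimality_le:
  assumes T: "1 \<le> T" and \<mu>\<^sub>1: "\<mu>\<^sub>1 \<in> sa_simplex M" and \<pi>\<^sub>0: "\<pi>\<^sub>0 \<in> policies M" and \<pi>': "\<pi>' \<in> policies M"
    and ac: "\<And>z. z \<in> Z \<Longrightarrow> pmf \<mu>\<^sub>1 z = 0 \<Longrightarrow> occupancy M \<pi>' z = 0"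
  defines "Q \<equiv> comida_mdp M \<eta>\<^sub>v \<eta>\<^sub>\<mu> (4 * \<eta>\<^sub>\<mu>) \<mu>\<^sub>1 \<pi>\<^sub>0 T"
  shows "measure_pmf.expectation Q (suboptimality M \<pi>')
    \<le> (\<Sum>z\<in>Z. occupancy M \<pi>' z * ln (occupancy M \<pi>' z / pmf \<mu>\<^sub>1 z)) / (\<eta>\<^sub>\<mu> * real T)
      + (\<eta>\<^sub>\<mu> + 2 * \<eta>\<^sub>v + (1 / (\<eta>\<^sub>v * real T) + 4 * \<eta>\<^sub>\<mu>)
        * measure_pmf.expectation Q (\<lambda>\<pi>. (L2_set (bias M \<pi>) S)\<^sup>2))"
proof -
  let ?I = "iterates T (\<lambda>_. 0, \<mu>\<^sub>1)" and ?x = "occupancy M \<pi>'"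
  define u where "u xs = bias M (output_policy M \<pi>\<^sub>0 xs)" for xs
  \<comment> \<open>The two quadratic penalties in \<open>potential_gap\<close> coincide for
    \<open>v = 0\<close>, and their halves add up to \<open>1 / \<eta>\<^sub>v\<close>.\<close>
  define c where "c = 1 / \<eta>\<^sub>v + real T * (4 * \<eta>\<^sub>\<mu>)"
  define E\<^sub>s where "E\<^sub>s = measure_pmf.expectation Q (suboptimality M \<pi>')"
  define E\<^sub>b where "E\<^sub>b = measure_pmf.expectation Q (\<lambda>\<pi>. (L2_set (bias M \<pi>) S)\<^sup>2)"
  define KL where "KL = (\<Sum>z\<in>Z. ?x z * ln (?x z / pmf \<mu>\<^sub>1 z))"
  have int: "integrable ?I f" for f :: "_ \<Rightarrow> real"
    by (rule integrable_measure_pmf_finite[OF iterates_support(1)[OF \<mu>\<^sub>1]])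
  have "real T * E\<^sub>s - c * E\<^sub>b = measure_pmf.expectation ?I
      (\<lambda>xs. real T * suboptimality M \<pi>' (output_policy M \<pi>\<^sub>0 xs) - c * (L2_set (u xs) S)\<^sup>2)"
    unfolding E\<^sub>s_def E\<^sub>b_def Q_def comida_mdp_eq u_def using int by simp
  also have "\<dots> \<le> measure_pmf.expectation ?I (\<lambda>xs. potential_gap ?x (u xs) (\<lambda>_. 0) (\<lambda>_. 0) xs)"
  proof (intro integral_mono_AE int)
    show "AE xs in ?I. real T * suboptimality M \<pi>' (output_policy M \<pi>\<^sub>0 xs) - c * (L2_set (u xs) S)\<^sup>2
        \<le> potential_gap ?x (u xs) (\<lambda>_. 0) (\<lambda>_. 0) xs"
      unfolding AE_measure_pmf_iff
    proof
      fix xs assume "xs \<in> set_pmf ?I"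
      then have xs: "length xs = T" "xs \<noteq> []" "\<And>y. y \<in> set xs \<Longrightarrow> snd y \<in> sa_simplex M"
        using iterates_support(2)[OF \<mu>\<^sub>1, of T "\<lambda>_. 0"] T by auto
      have "real T * (4 * \<eta>\<^sub>\<mu>) * (sup_norm M (u xs))\<^sup>2 \<le> real T * (4 * \<eta>\<^sub>\<mu>) * (L2_set (u xs) S)\<^sup>2"
        using \<eta>\<^sub>\<mu>_pos by (intro mult_left_mono sup_norm_square_le) auto
      moreover have "potential_gap ?x (u xs) (\<lambda>_. 0) (\<lambda>_. 0) xs
          = real T * suboptimality M \<pi>' (output_policy M \<pi>\<^sub>0 xs) - (L2_set (u xs) S)\<^sup>2 / \<eta>\<^sub>v
            - real T * (4 * \<eta>\<^sub>\<mu>) * (sup_norm M (u xs))\<^sup>2"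
        using sum_gap[OF xs(2,3) \<pi>\<^sub>0 \<pi>'] unfolding potential_gap_def u_def xs(1) L2_set_squared by simp
      moreover have "c * (L2_set (u xs) S)\<^sup>2
          = (L2_set (u xs) S)\<^sup>2 / \<eta>\<^sub>v + real T * (4 * \<eta>\<^sub>\<mu>) * (L2_set (u xs) S)\<^sup>2"
        unfolding c_def by (simp add: distrib_right)
      ultimately show "real T * suboptimality M \<pi>' (output_policy M \<pi>\<^sub>0 xs) - c * (L2_set (u xs) S)\<^sup>2
          \<le> potential_gap ?x (u xs) (\<lambda>_. 0) (\<lambda>_. 0) xs"
        by linarith
    qed
  qed
  also have "\<dots> \<le> KL / \<eta>\<^sub>\<mu> + real T * (\<eta>\<^sub>\<mu> + 2 * \<eta>\<^sub>v)"
  proof -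
    have "sup_norm M (\<lambda>_. 0) = 0" using states_ne by (simp add: sup_norm_def image_constant_conv)
    then show ?thesis
      using expected_potential_gap[OF \<mu>\<^sub>1 occupancy_nonneg[OF \<pi>'] sum_occupancy[OF \<pi>'] ac, of T "\<lambda>_. 0" u "\<lambda>_. 0"]
      by (simp add: KL_def)
  qed
  finally have "real T * E\<^sub>s \<le> KL / \<eta>\<^sub>\<mu> + real T * (\<eta>\<^sub>\<mu> + 2 * \<eta>\<^sub>v) + c * E\<^sub>b" by simp
  also have "\<dots> = real T * (KL / (\<eta>\<^sub>\<mu> * real T) + (\<eta>\<^sub>\<mu> + 2 * \<eta>\<^sub>v + (1 / (\<eta>\<^sub>v * real T) + 4 * \<eta>\<^sub>\<mu>) * E\<^sub>b))"
    using T \<eta>\<^sub>v_pos \<eta>\<^sub>\<mu>_pos unfolding c_def by (simp add: field_simps)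
  finally show ?thesis
    using T unfolding E\<^sub>s_def E\<^sub>b_def KL_def by (simp add: mult_le_cancel_left)
qed

section \<open>Auxiliary bounds for the tuned parameters\<close>

lemma expected_suboptimality_nonneg:
  assumes "1 \<le> T" "\<mu>\<^sub>1 \<in> sa_simplex M" "\<pi>\<^sub>0 \<in> policies M" "optimal_policy M \<pi>'"
  shows "0 \<le> measure_pmf.expectation (comida_mdp M \<eta>\<^sub>v \<eta>\<^sub>\<mu> (4 * \<eta>\<^sub>\<mu>) \<mu>\<^sub>1 \<pi>\<^sub>0 T) (suboptimality M \<pi>')"
proof (rule integral_nonneg_AE)
  obtain s where s: "s \<in> S" using states_ne by blast
  have "0 \<le> suboptimality M \<pi>' \<pi>" if "\<pi> \<in> policies M" for \<pi>
    using suboptimality_eq[OF that _ s, of \<pi>'] assms(4) that s unfolding optimal_policy_def by simp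
  then show "AE \<pi> in comida_mdp M \<eta>\<^sub>v \<eta>\<^sub>\<mu> (4 * \<eta>\<^sub>\<mu>) \<mu>\<^sub>1 \<pi>\<^sub>0 T. 0 \<le> suboptimality M \<pi>' \<pi>"
    using iterates_output_in_policies[OF assms(1-3)] unfolding comida_mdp_eq AE_measure_pmf_iff by auto
qed

lemma expected_bias_square_le:
  fixes \<pi>\<^sub>0 :: "'s \<Rightarrow> 'a pmf" and T :: nat
  assumes "\<mu>\<^sub>1 \<in> sa_simplex M"
  defines "Q \<equiv> comida_mdp M \<eta>\<^sub>v \<eta>\<^sub>\<mu> (4 * \<eta>\<^sub>\<mu>) \<mu>\<^sub>1 \<pi>\<^sub>0 T"
  assumes B: "\<And>\<pi>. \<pi> \<in> set_pmf Q \<Longrightarrow> sup_norm M (bias M \<pi>) \<le> B"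
  shows "measure_pmf.expectation Q (\<lambda>\<pi>. (L2_set (bias M \<pi>) S)\<^sup>2) \<le> real (card S) * B\<^sup>2"
proof -
  have "integrable Q (\<lambda>\<pi>. (L2_set (bias M \<pi>) S)\<^sup>2)"
    using iterates_support(1)[OF assms(1)] unfolding Q_def comida_mdp_eq
    by (intro integrable_measure_pmf_finite) simp
  moreover have "(L2_set (bias M \<pi>) S)\<^sup>2 \<le> real (card S) * B\<^sup>2" if "\<pi> \<in> set_pmf Q" for \<pi>
  proof -
    have "(bias M \<pi> s)\<^sup>2 \<le> B\<^sup>2" if "s \<in> S" for s
      using B[OF \<open>\<pi> \<in> set_pmf Q\<close>] abs_le_sup_norm[OF finite_states that, of "bias M \<pi>"]
      by (intro abs_le_square_iff[THEN iffD1]) linarith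
    then show ?thesis
      unfolding L2_set_squared using sum_bounded_above[of S "\<lambda>s. (bias M \<pi> s)\<^sup>2" "B\<^sup>2"] by simp
  qed
  ultimately show ?thesis
    by (intro measure_pmf.integral_le_const) (auto simp: AE_measure_pmf_iff)
qed

text \<open>Occupancies are at most 1 and uniform weights are the reciprocal of the number of pairs,
  so no logarithm with positive weight exceeds that of this number.\<close>

lemma relative_entropy_uniform_le:
  assumes "\<pi> \<in> policies M"
  shows "(\<Sum>z\<in>Z. occupancy M \<pi> z * ln (occupancy M \<pi> z / pmf (pmf_of_set Z) z))
    \<le> ln (real (card S) * real (card A))"
proof -
  let ?x = "occupancy M \<pi>" and ?N = "real (card S) * real (card A)"
  have N: "0 < ?N" using finite_states states_ne finite_actions actions_ne by (simp add: card_gt_0_iff)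
  have "?x z * ln (?x z / pmf (pmf_of_set Z) z) \<le> ?x z * ln ?N" if z: "z \<in> Z" for z
  proof (cases "?x z = 0")
    case False
    then have pos: "0 < ?x z" using occupancy_nonneg[OF assms, of z] by simp
    have "?x z \<le> sum ?x Z"
      using z finite_Z occupancy_nonneg[OF assms] by (intro member_le_sum) auto
    then have "?x z \<le> 1" using sum_occupancy[OF assms] by simp
    moreover have "?x z / pmf (pmf_of_set Z) z = ?x z * ?N"
      using z finite_Z by (subst pmf_of_set) (auto simp: card_cartesian_product)
    ultimately show ?thesis using pos N by (intro mult_left_mono) (auto intro: mult_left_le_one_le)
  qed simp
  then have "(\<Sum>z\<in>Z. ?x z * ln (?x z / pmf (pmf_of_set Z) z)) \<le> (\<Sum>z\<in>Z. ?x z * ln ?N)"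
    by (rule sum_mono)
  also have "\<dots> = ln ?N" using sum_occupancy[OF assms] by (simp flip: sum_distrib_right)
  finally show ?thesis .
qed

end

text \<open>Since \<open>SA > 1\<close> forces \<open>ln (SA) \<ge> ln 2 \<ge> 1/4\<close>, the terms without a logarithm are dominated
  as well; the lower bound \<open>b\<close> on \<open>B\<close> absorbs the terms without the bias.\<close>

lemma tuned_bound:
  fixes S A T B b :: real
  defines "L \<equiv> ln (S * A)"
  defines "m \<equiv> sqrt (L / (S * T))" and "n \<equiv> sqrt (S * A / T)"
  assumes "1 \<le> S" "1 \<le> A" "2 \<le> S * A" "1 \<le> T" "0 < b" "b \<le> B"
  shows "L / (m * T) + (m + 2 * n + (1 / (n * T) + 4 * m) * (S * B\<^sup>2))
    \<le> (6 / b\<^sup>2 + 6) * sqrt (B ^ 4 * S * A * L / T)"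
proof -
  define R where "R = sqrt (S * A * L / T)"
  \<comment> \<open>Follows from \<open>exp (1/4) \<le> 1 + 1/4 + 1/16 \<le> 2\<close>. The value
    1/4 makes the later factor \<open>sqrt 4 = 2\<close> exact.\<close>
  have "1 / 4 \<le> ln (2 :: real)"
    using ln_ge_iff[of 2 "1/4 :: real"] exp_le_cancel_iff[of "1/4" "1/4"] exp_bound[of "1/4 :: real"]
    by (simp add: power2_eq_square)
  also have "\<dots> \<le> L" unfolding L_def using assms by simp
  finally have L: "1 / 4 \<le> L" .
  have pos: "0 < S" "0 < A" "0 < T" "0 < L" using assms L by auto
  then have "0 < m" "0 < n" unfolding m_def n_def by auto
  have R_ge: "sqrt (x / T) \<le> R" if "x \<le> S * A * L" for x
    unfolding R_def using that pos by (intro real_sqrt_le_mono divide_right_mono) auto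
  have "L * 1 * S \<le> L * A * S" using pos assms by (intro mult_right_mono mult_left_mono) auto
  then have LS: "L * S \<le> S * A * L" by (simp add: mult_ac)
  have 1: "L / (m * T) \<le> R"
  proof -
    have "L / (m * T) = sqrt (L * S / T)"
    proof -
      have "(m * T) * sqrt (L * S / T) = sqrt (L / (S * T) * (L * S / T)) * T"
        unfolding m_def by (simp only: real_sqrt_mult) simp
      also have "L / (S * T) * (L * S / T) = (L / T)\<^sup>2" using pos by (simp add: power2_eq_square)
      also have "sqrt \<dots> * T = L" using pos by simp
      finally show ?thesis using \<open>0 < m\<close> pos by (simp add: divide_eq_eq mult_ac)
    qed
    then show ?thesis using R_ge[OF LS] by simp
  qed
  have mS: "m * S \<le> R"
  proof -
    have "m * S = sqrt (L / (S * T)) * sqrt (S\<^sup>2)" unfolding m_def using pos by simp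
    also have "\<dots> = sqrt (L * S / T)"
      unfolding real_sqrt_mult[symmetric] using pos by (simp add: power2_eq_square)
    finally show ?thesis using R_ge[OF LS] by simp
  qed
  have 2: "m \<le> R"
  proof -
    have "m * 1 \<le> m * S" using \<open>0 < m\<close> assms by (intro mult_left_mono) auto
    then show ?thesis using mS by simp
  qed
  have 3: "n \<le> 2 * R"
  proof -
    have "n \<le> sqrt (4 * (S * A * L / T))"
      unfolding n_def
    proof (intro real_sqrt_le_mono)
      have "S * A * 1 \<le> S * A * (4 * L)" using L pos by (intro mult_left_mono) auto
      then have "S * A * 1 / T \<le> S * A * (4 * L) / T" using pos by (intro divide_right_mono) auto
      then show "S * A / T \<le> 4 * (S * A * L / T)" by (simp add: mult_ac)
    qed
    also have "\<dots> = 2 * R" unfolding R_def real_sqrt_mult by simp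
    finally show ?thesis .
  qed
  have 4: "S / (n * T) \<le> 2 * R"
  proof -
    \<comment> \<open>The choice of \<open>n\<close> makes \<open>1 / (n * T)\<close> equal to
      \<open>n / (S * A)\<close>, so this term reduces to the bound for \<open>n\<close>.\<close>
    have "n * n * T = S * A" unfolding n_def using pos by simp
    then have "S / (n * T) = n / A" using pos \<open>0 < n\<close> by (simp add: frac_eq_eq mult_ac)
    also have "\<dots> \<le> n" using \<open>0 < n\<close> \<open>1 \<le> A\<close> by (simp add: divide_le_eq mult_le_cancel_left1)
    finally show ?thesis using 3 by simp
  qed
  have "0 \<le> R" unfolding R_def using pos by simp
  have B: "0 < B" "b\<^sup>2 \<le> B\<^sup>2" using assms by (auto intro: power_mono)
  have "L / (m * T) + (m + 2 * n + (1 / (n * T) + 4 * m) * (S * B\<^sup>2))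
      = L / (m * T) + m + 2 * n + (S / (n * T) + 4 * (m * S)) * B\<^sup>2"
    by (simp add: algebra_simps)
  \<comment> \<open>Both sixes of the final constant: \<open>1 + 1 + 4\<close> without the bias,
    \<open>2 + 4\<close> with it.\<close>
  also have "\<dots> \<le> R + R + 2 * (2 * R) + (2 * R + 4 * R) * B\<^sup>2"
    by (intro add_mono mult_right_mono mult_left_mono 1 2 3 4 mS) auto
  also have "\<dots> = 6 * R * 1 + 6 * R * B\<^sup>2" by (simp add: algebra_simps)
  also have "\<dots> \<le> 6 * R * (B\<^sup>2 / b\<^sup>2) + 6 * R * B\<^sup>2"
    using B assms \<open>0 \<le> R\<close> by (intro add_mono mult_left_mono) auto
  also have "\<dots> = (6 / b\<^sup>2 + 6) * (B\<^sup>2 * R)" by (simp add: algebra_simps)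
  also have "B\<^sup>2 * R = sqrt (B ^ 4 * S * A * L / T)"
  proof -
    have "sqrt (B ^ 4) = B\<^sup>2" by (rule real_sqrt_unique) auto
    then show ?thesis unfolding R_def by (metis real_sqrt_mult times_divide_eq_right mult.assoc)
  qed
  finally show ?thesis .
qed

(* Second part: the implied constant C is universal over all MDPs, horizons and all B bounded away
   from 0. It cannot be uniform as B tends to 0: with one state the bias vanishes, so every B > 0
   is admissible, while the suboptimality need not be 0. *)
theorem theorem4p1:
  "(\<forall>(M :: ('s, 'a) mdp) (T :: nat) (\<eta>\<^sub>v :: real) (\<eta>\<^sub>\<mu> :: real) \<mu>\<^sub>1 \<pi>\<^sub>0 \<pi>\<^sub>o\<^sub>p\<^sub>t.
      average_reward_mdp M \<and> T \<ge> 1 \<and> \<eta>\<^sub>v > 0 \<and> \<eta>\<^sub>\<mu> > 0 \<and> \<mu>\<^sub>1 \<in> sa_simplex M \<and>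
      \<pi>\<^sub>0 \<in> policies M \<and> optimal_policy M \<pi>\<^sub>o\<^sub>p\<^sub>t \<longrightarrow>
      ereal (measure_pmf.expectation (comida_mdp M \<eta>\<^sub>v \<eta>\<^sub>\<mu> (4 * \<eta>\<^sub>\<mu>) \<mu>\<^sub>1 \<pi>\<^sub>0 T)
               (\<lambda>\<pi>. suboptimality M \<pi>\<^sub>o\<^sub>p\<^sub>t \<pi>))
        \<le> KL_div M (occupancy M \<pi>\<^sub>o\<^sub>p\<^sub>t) (pmf \<mu>\<^sub>1) / ereal (\<eta>\<^sub>\<mu> * real T)
          + ereal (\<eta>\<^sub>\<mu> + 2 * \<eta>\<^sub>v
              + (1 / (\<eta>\<^sub>v * real T) + 4 * \<eta>\<^sub>\<mu>)
                * measure_pmf.expectation (comida_mdp M \<eta>\<^sub>v \<eta>\<^sub>\<mu> (4 * \<eta>\<^sub>\<mu>) \<mu>\<^sub>1 \<pi>\<^sub>0 T)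
                    (\<lambda>\<pi>. (L2_set (bias M \<pi>) (states M))\<^sup>2)))
   \<and>
   (\<forall>b > 0. \<exists>C. \<forall>(M :: ('s, 'a) mdp) (T :: nat) (B :: real) S A \<eta>\<^sub>v \<eta>\<^sub>\<mu> \<mu>\<^sub>1 \<pi>\<^sub>0 \<pi>\<^sub>o\<^sub>p\<^sub>t.
      average_reward_mdp M \<and> T \<ge> 1 \<and> B \<ge> b \<and>
      S = real (card (states M)) \<and> A = real (card (actions M)) \<and>
      \<eta>\<^sub>\<mu> = sqrt (ln (S * A) / (S * real T)) \<and> \<eta>\<^sub>\<mu> > 0 \<and> \<eta>\<^sub>v = sqrt (S * A / real T) \<and>
      \<mu>\<^sub>1 = pmf_of_set (states M \<times> actions M) \<and>
      \<pi>\<^sub>0 \<in> policies M \<and> optimal_policy M \<pi>\<^sub>o\<^sub>p\<^sub>t \<and>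
      (\<forall>\<pi>\<in>set_pmf (comida_mdp M \<eta>\<^sub>v \<eta>\<^sub>\<mu> (4 * \<eta>\<^sub>\<mu>) \<mu>\<^sub>1 \<pi>\<^sub>0 T). sup_norm M (bias M \<pi>) \<le> B) \<longrightarrow>
      \<bar>measure_pmf.expectation (comida_mdp M \<eta>\<^sub>v \<eta>\<^sub>\<mu> (4 * \<eta>\<^sub>\<mu>) \<mu>\<^sub>1 \<pi>\<^sub>0 T)
         (\<lambda>\<pi>. suboptimality M \<pi>\<^sub>o\<^sub>p\<^sub>t \<pi>)\<bar>
        \<le> C * sqrt (B ^ 4 * S * A * ln (S * A) / real T))"
proof (intro conjI allI impI)
  fix M :: "('s, 'a) mdp" and T :: nat and \<eta>\<^sub>v \<eta>\<^sub>\<mu> :: real and \<mu>\<^sub>1 \<pi>\<^sub>0 \<pi>\<^sub>o\<^sub>p\<^sub>t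
  assume *: "average_reward_mdp M \<and> T \<ge> 1 \<and> \<eta>\<^sub>v > 0 \<and> \<eta>\<^sub>\<mu> > 0 \<and> \<mu>\<^sub>1 \<in> sa_simplex M \<and>
      \<pi>\<^sub>0 \<in> policies M \<and> optimal_policy M \<pi>\<^sub>o\<^sub>p\<^sub>t"
  interpret comida M \<eta>\<^sub>v \<eta>\<^sub>\<mu> by unfold_locales (use * in auto)
  have \<pi>: "\<pi>\<^sub>o\<^sub>p\<^sub>t \<in> policies M" using * unfolding optimal_policy_def by blast
  let ?Q = "comida_mdp M \<eta>\<^sub>v \<eta>\<^sub>\<mu> (4 * \<eta>\<^sub>\<mu>) \<mu>\<^sub>1 \<pi>\<^sub>0 T"
  show "ereal (measure_pmf.expectation ?Q (\<lambda>\<pi>. suboptimality M \<pi>\<^sub>o\<^sub>p\<^sub>t \<pi>))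
    \<le> KL_div M (occupancy M \<pi>\<^sub>o\<^sub>p\<^sub>t) (pmf \<mu>\<^sub>1) / ereal (\<eta>\<^sub>\<mu> * real T)
      + ereal (\<eta>\<^sub>\<mu> + 2 * \<eta>\<^sub>v + (1 / (\<eta>\<^sub>v * real T) + 4 * \<eta>\<^sub>\<mu>)
        * measure_pmf.expectation ?Q (\<lambda>\<pi>. (L2_set (bias M \<pi>) (states M))\<^sup>2))"
  proof (cases "\<exists>z\<in>states M \<times> actions M. occupancy M \<pi>\<^sub>o\<^sub>p\<^sub>t z \<noteq> 0 \<and> pmf \<mu>\<^sub>1 z = 0")
    case True
    then have "KL_div M (occupancy M \<pi>\<^sub>o\<^sub>p\<^sub>t) (pmf \<mu>\<^sub>1) = \<infinity>" unfolding KL_div_def by (rule if_P)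
    moreover have "0 < \<eta>\<^sub>\<mu> * real T" using * by simp
    ultimately show ?thesis by simp
  next
    case False
    then have KL: "KL_div M (occupancy M \<pi>\<^sub>o\<^sub>p\<^sub>t) (pmf \<mu>\<^sub>1) = ereal (\<Sum>z\<in>states M \<times> actions M.
        occupancy M \<pi>\<^sub>o\<^sub>p\<^sub>t z * ln (occupancy M \<pi>\<^sub>o\<^sub>p\<^sub>t z / pmf \<mu>\<^sub>1 z))"
      unfolding KL_div_def by (rule if_not_P)
    have "\<eta>\<^sub>\<mu> * real T \<noteq> 0" using * by simp
    moreover have "occupancy M \<pi>\<^sub>o\<^sub>p\<^sub>t z = 0" if "z \<in> states M \<times> actions M" "pmf \<mu>\<^sub>1 z = 0" for z
      using False that by blast
    ultimately show ?thesis
      using expected_suboptimality_le[of T \<mu>\<^sub>1 \<pi>\<^sub>0 \<pi>\<^sub>o\<^sub>p\<^sub>t] * \<pi> unfolding KL by simp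
  qed
next
  fix b :: real assume "0 < b"
  show "\<exists>C. \<forall>(M :: ('s, 'a) mdp) (T :: nat) (B :: real) S A \<eta>\<^sub>v \<eta>\<^sub>\<mu> \<mu>\<^sub>1 \<pi>\<^sub>0 \<pi>\<^sub>o\<^sub>p\<^sub>t.
      average_reward_mdp M \<and> T \<ge> 1 \<and> B \<ge> b \<and>
      S = real (card (states M)) \<and> A = real (card (actions M)) \<and>
      \<eta>\<^sub>\<mu> = sqrt (ln (S * A) / (S * real T)) \<and> \<eta>\<^sub>\<mu> > 0 \<and> \<eta>\<^sub>v = sqrt (S * A / real T) \<and>
      \<mu>\<^sub>1 = pmf_of_set (states M \<times> actions M) \<and>
      \<pi>\<^sub>0 \<in> policies M \<and> optimal_policy M \<pi>\<^sub>o\<^sub>p\<^sub>t \<and>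
      (\<forall>\<pi>\<in>set_pmf (comida_mdp M \<eta>\<^sub>v \<eta>\<^sub>\<mu> (4 * \<eta>\<^sub>\<mu>) \<mu>\<^sub>1 \<pi>\<^sub>0 T). sup_norm M (bias M \<pi>) \<le> B) \<longrightarrow>
      \<bar>measure_pmf.expectation (comida_mdp M \<eta>\<^sub>v \<eta>\<^sub>\<mu> (4 * \<eta>\<^sub>\<mu>) \<mu>\<^sub>1 \<pi>\<^sub>0 T)
         (\<lambda>\<pi>. suboptimality M \<pi>\<^sub>o\<^sub>p\<^sub>t \<pi>)\<bar>
        \<le> C * sqrt (B ^ 4 * S * A * ln (S * A) / real T)"
  proof (intro exI allI impI, elim conjE)
    fix M :: "('s, 'a) mdp" and T :: nat and B S A \<eta>\<^sub>v \<eta>\<^sub>\<mu> :: real and \<mu>\<^sub>1 \<pi>\<^sub>0 \<pi>\<^sub>o\<^sub>p\<^sub>t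
    assume M: "average_reward_mdp M" and T: "1 \<le> T" and B: "b \<le> B"
      and S: "S = real (card (states M))" and A: "A = real (card (actions M))"
      and \<eta>\<^sub>\<mu>: "\<eta>\<^sub>\<mu> = sqrt (ln (S * A) / (S * real T))" "0 < \<eta>\<^sub>\<mu>" and \<eta>\<^sub>v: "\<eta>\<^sub>v = sqrt (S * A / real T)"
      and \<mu>\<^sub>1: "\<mu>\<^sub>1 = pmf_of_set (states M \<times> actions M)"
      and \<pi>\<^sub>0: "\<pi>\<^sub>0 \<in> policies M" and opt: "optimal_policy M \<pi>\<^sub>o\<^sub>p\<^sub>t"
      and bias: "\<forall>\<pi>\<in>set_pmf (comida_mdp M \<eta>\<^sub>v \<eta>\<^sub>\<mu> (4 * \<eta>\<^sub>\<mu>) \<mu>\<^sub>1 \<pi>\<^sub>0 T). sup_norm M (bias M \<pi>) \<le> B"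
    interpret ergodic_mdp M by unfold_locales (rule M)
    have SA: "1 \<le> S" "1 \<le> A"
      unfolding S A using finite_states states_ne finite_actions actions_ne
      by (simp_all add: Suc_le_eq card_gt_0_iff)
    \<comment> \<open>With a single state-action pair the logarithm vanishes and so does the tuned
      \<open>\<eta>\<^sub>\<mu>\<close>, which is assumed positive.\<close>
    have "S * A \<noteq> 1" using \<eta>\<^sub>\<mu> by auto
    then have "card (states M) * card (actions M) \<noteq> 1" unfolding S A by (metis of_nat_1 of_nat_mult)
    moreover have "card (states M) * card (actions M) \<noteq> 0" using SA unfolding S A by auto
    ultimately have "2 \<le> card (states M) * card (actions M)" by linarith
    then have SA2: "2 \<le> S * A" unfolding S A by (metis of_nat_le_iff of_nat_mult of_nat_numeral)
    interpret comida M \<eta>\<^sub>v \<eta>\<^sub>\<mu>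
      by unfold_locales (use SA T \<eta>\<^sub>\<mu>(2) in \<open>auto simp: \<eta>\<^sub>v\<close>)
    let ?Q = "comida_mdp M \<eta>\<^sub>v \<eta>\<^sub>\<mu> (4 * \<eta>\<^sub>\<mu>) \<mu>\<^sub>1 \<pi>\<^sub>0 T"
    let ?E = "measure_pmf.expectation ?Q (\<lambda>\<pi>. suboptimality M \<pi>\<^sub>o\<^sub>p\<^sub>t \<pi>)"
    let ?E\<^sub>b = "measure_pmf.expectation ?Q (\<lambda>\<pi>. (L2_set (bias M \<pi>) (states M))\<^sup>2)"
    have Z: "states M \<times> actions M \<noteq> {}" using states_ne actions_ne by simp
    have simplex: "\<mu>\<^sub>1 \<in> sa_simplex M" unfolding \<mu>\<^sub>1 sa_simplex_def using Z finite_Z by simp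
    have \<pi>: "\<pi>\<^sub>o\<^sub>p\<^sub>t \<in> policies M" using opt unfolding optimal_policy_def by blast
    have "?E \<le> (\<Sum>z\<in>states M \<times> actions M. occupancy M \<pi>\<^sub>o\<^sub>p\<^sub>t z * ln (occupancy M \<pi>\<^sub>o\<^sub>p\<^sub>t z / pmf \<mu>\<^sub>1 z)) / (\<eta>\<^sub>\<mu> * real T)
        + (\<eta>\<^sub>\<mu> + 2 * \<eta>\<^sub>v + (1 / (\<eta>\<^sub>v * real T) + 4 * \<eta>\<^sub>\<mu>) * ?E\<^sub>b)"
      by (rule expected_suboptimality_le[OF T simplex \<pi>\<^sub>0 \<pi>]) (use Z finite_Z in \<open>simp add: \<mu>\<^sub>1\<close>)
    also have "\<dots> \<le> ln (S * A) / (\<eta>\<^sub>\<mu> * real T)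
        + (\<eta>\<^sub>\<mu> + 2 * \<eta>\<^sub>v + (1 / (\<eta>\<^sub>v * real T) + 4 * \<eta>\<^sub>\<mu>) * (S * B\<^sup>2))"
      using relative_entropy_uniform_le[OF \<pi>] expected_bias_square_le[OF simplex, of \<pi>\<^sub>0 T B] bias
        \<eta>\<^sub>v_pos \<eta>\<^sub>\<mu>_pos
      unfolding S A \<mu>\<^sub>1 by (intro add_mono divide_right_mono mult_left_mono order_refl) auto
    also have "\<dots> \<le> (6 / b\<^sup>2 + 6) * sqrt (B ^ 4 * S * A * ln (S * A) / real T)"
      unfolding \<eta>\<^sub>\<mu>(1) \<eta>\<^sub>v using SA SA2 T \<open>0 < b\<close> B by (intro tuned_bound) auto
    \<comment> \<open>Optimality of the comparator makes the expectation nonnegative, so the upper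
      bound also bounds the absolute value.\<close>
    finally show "\<bar>?E\<bar> \<le> (6 / b\<^sup>2 + 6) * sqrt (B ^ 4 * S * A * ln (S * A) / real T)"
      using expected_suboptimality_nonneg[OF T simplex \<pi>\<^sub>0 opt] by simp
  qed
qed

end
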